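(* Let $U$ be any consistent computably enumerable theory extending $\mathsf{EA}$. Then there exists a $\Pi^0_1$-formula $\rho(x)$ such that: (Independence) for every sentence $\phi$, if $U+\phi$ is consistent, then both $U+\phi+\rho(\ulcorner\phi\urcorner)$ and $U+\phi+\neg\rho(\ulcorner\phi\urcorner)$ are consistent; (Consistent Extensionality) for all sentences $\phi,\psi$, if $U+\phi$ is consistent and $U\vdash\phi\leftrightarrow\psi$, then $\mathsf{EA}\vdash\rho(\ulcorner\phi\urcorner)\leftrightarrow\rho(\ulcorner\psi\urcorner)$.
   Context: $\mathsf{EA}$ is Elementary Arithmetic, $\mathrm{I}\Delta_0+\mathsf{Exp}$. $\ulcorner\phi\urcorner$ denotes the numeral of the Gödel number of $\phi$. *)

theory Defs
  imports Main "HOL-Library.Nat_Bijection"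
begin

section \<open>Syntax of first-order arithmetic (language 0, S, +, *, 2^x, =, \<le>), de Bruijn indices\<close>

datatype trm = Var nat | Zr | Sc trm | Pl trm trm | Tm trm trm | Ex2 trm

datatype fm = Fls | Eqt trm trm | Leq trm trm | Imp fm fm | Forall fm

definition Neg :: "fm \<Rightarrow> fm" where "Neg A = Imp A Fls"
definition Conj :: "fm \<Rightarrow> fm \<Rightarrow> fm" where "Conj A B = Neg (Imp A (Neg B))"
definition Disj :: "fm \<Rightarrow> fm \<Rightarrow> fm" where "Disj A B = Imp (Neg A) B"
definition Iff :: "fm \<Rightarrow> fm \<Rightarrow> fm" where "Iff A B = Conj (Imp A B) (Imp B A)"
definition Exists :: "fm \<Rightarrow> fm" where "Exists A = Neg (Forall (Neg A))"

fun liftT :: "nat \<Rightarrow> trm \<Rightarrow> trm" where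
  "liftT k (Var i) = Var (if i < k then i else Suc i)"
| "liftT k Zr = Zr"
| "liftT k (Sc t) = Sc (liftT k t)"
| "liftT k (Pl t s) = Pl (liftT k t) (liftT k s)"
| "liftT k (Tm t s) = Tm (liftT k t) (liftT k s)"
| "liftT k (Ex2 t) = Ex2 (liftT k t)"

fun liftF :: "nat \<Rightarrow> fm \<Rightarrow> fm" where
  "liftF k Fls = Fls"
| "liftF k (Eqt t s) = Eqt (liftT k t) (liftT k s)"
| "liftF k (Leq t s) = Leq (liftT k t) (liftT k s)"
| "liftF k (Imp A B) = Imp (liftF k A) (liftF k B)"
| "liftF k (Forall A) = Forall (liftF (Suc k) A)"

fun substT :: "nat \<Rightarrow> trm \<Rightarrow> trm \<Rightarrow> trm" where
  "substT k u (Var i) = (if i < k then Var i else if i = k then u else Var (i - 1))"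
| "substT k u Zr = Zr"
| "substT k u (Sc t) = Sc (substT k u t)"
| "substT k u (Pl t s) = Pl (substT k u t) (substT k u s)"
| "substT k u (Tm t s) = Tm (substT k u t) (substT k u s)"
| "substT k u (Ex2 t) = Ex2 (substT k u t)"

fun substF :: "nat \<Rightarrow> trm \<Rightarrow> fm \<Rightarrow> fm" where
  "substF k u Fls = Fls"
| "substF k u (Eqt t s) = Eqt (substT k u t) (substT k u s)"
| "substF k u (Leq t s) = Leq (substT k u t) (substT k u s)"
| "substF k u (Imp A B) = Imp (substF k u A) (substF k u B)"
| "substF k u (Forall A) = Forall (substF (Suc k) (liftT 0 u) A)"

definition inst :: "fm \<Rightarrow> trm \<Rightarrow> fm" where "inst A t = substF 0 t A"

fun closedT :: "nat \<Rightarrow> trm \<Rightarrow> bool" where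
  "closedT n (Var i) = (i < n)"
| "closedT n Zr = True"
| "closedT n (Sc t) = closedT n t"
| "closedT n (Pl t s) = (closedT n t \<and> closedT n s)"
| "closedT n (Tm t s) = (closedT n t \<and> closedT n s)"
| "closedT n (Ex2 t) = closedT n t"

fun closedF :: "nat \<Rightarrow> fm \<Rightarrow> bool" where
  "closedF n Fls = True"
| "closedF n (Eqt t s) = (closedT n t \<and> closedT n s)"
| "closedF n (Leq t s) = (closedT n t \<and> closedT n s)"
| "closedF n (Imp A B) = (closedF n A \<and> closedF n B)"
| "closedF n (Forall A) = closedF (Suc n) A"

definition sentence :: "fm \<Rightarrow> bool" where "sentence A = closedF 0 A"

fun close :: "nat \<Rightarrow> fm \<Rightarrow> fm" where
  "close 0 A = A"
| "close (Suc n) A = Forall (close n A)"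

fun num :: "nat \<Rightarrow> trm" where
  "num 0 = Zr"
| "num (Suc n) = Sc (num n)"

inductive Delta0 :: "fm \<Rightarrow> bool" where
  "Delta0 Fls"
| "Delta0 (Eqt t s)"
| "Delta0 (Leq t s)"
| "Delta0 A \<Longrightarrow> Delta0 B \<Longrightarrow> Delta0 (Imp A B)"
| "Delta0 A \<Longrightarrow> Delta0 (Forall (Imp (Leq (Var 0) (liftT 0 t)) A))"

inductive Pi1 :: "fm \<Rightarrow> bool" where
  "Delta0 A \<Longrightarrow> Pi1 A"
| "Pi1 A \<Longrightarrow> Pi1 (Forall A)"

inductive Sigma1 :: "fm \<Rightarrow> bool" where
  "Delta0 A \<Longrightarrow> Sigma1 A"
| "Sigma1 A \<Longrightarrow> Sigma1 (Exists A)"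

fun evalT :: "(nat \<Rightarrow> nat) \<Rightarrow> trm \<Rightarrow> nat" where
  "evalT e (Var i) = e i"
| "evalT e Zr = 0"
| "evalT e (Sc t) = Suc (evalT e t)"
| "evalT e (Pl t s) = evalT e t + evalT e s"
| "evalT e (Tm t s) = evalT e t * evalT e s"
| "evalT e (Ex2 t) = 2 ^ evalT e t"

fun evalF :: "(nat \<Rightarrow> nat) \<Rightarrow> fm \<Rightarrow> bool" where
  "evalF e Fls = False"
| "evalF e (Eqt t s) = (evalT e t = evalT e s)"
| "evalF e (Leq t s) = (evalT e t \<le> evalT e s)"
| "evalF e (Imp A B) = (evalF e A \<longrightarrow> evalF e B)"
| "evalF e (Forall A) = (\<forall>n. evalF (case_nat n e) A)"

fun codeT :: "trm \<Rightarrow> nat" where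
  "codeT (Var i) = prod_encode (0, i)"
| "codeT Zr = prod_encode (1, 0)"
| "codeT (Sc t) = prod_encode (2, codeT t)"
| "codeT (Pl t s) = prod_encode (3, prod_encode (codeT t, codeT s))"
| "codeT (Tm t s) = prod_encode (4, prod_encode (codeT t, codeT s))"
| "codeT (Ex2 t) = prod_encode (5, codeT t)"

fun codeF :: "fm \<Rightarrow> nat" where
  "codeF Fls = prod_encode (0, 0)"
| "codeF (Eqt t s) = prod_encode (1, prod_encode (codeT t, codeT s))"
| "codeF (Leq t s) = prod_encode (2, prod_encode (codeT t, codeT s))"
| "codeF (Imp A B) = prod_encode (3, prod_encode (codeF A, codeF B))"
| "codeF (Forall A) = prod_encode (4, codeF A)"

definition app_code :: "fm \<Rightarrow> fm \<Rightarrow> fm" where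
  "app_code \<rho> \<phi> = inst \<rho> (num (codeF \<phi>))"

section \<open>Hilbert-style proof calculus (hypotheses are sentences)\<close>

inductive proves :: "fm set \<Rightarrow> fm \<Rightarrow> bool" where
  hyp: "A \<in> \<Gamma> \<Longrightarrow> proves \<Gamma> A"
| axK: "proves \<Gamma> (Imp A (Imp B A))"
| axS: "proves \<Gamma> (Imp (Imp A (Imp B C)) (Imp (Imp A B) (Imp A C)))"
| axDN: "proves \<Gamma> (Imp (Imp (Imp A Fls) Fls) A)"
| axInst: "proves \<Gamma> (Imp (Forall A) (inst A t))"
| axAllImp: "proves \<Gamma> (Imp (Forall (Imp (liftF 0 A) B)) (Imp A (Forall B)))"
| axRefl: "proves \<Gamma> (Eqt t t)"
| axLeib: "proves \<Gamma> (Imp (Eqt t s) (Imp (inst A t) (inst A s)))"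
| mp: "proves \<Gamma> (Imp A B) \<Longrightarrow> proves \<Gamma> A \<Longrightarrow> proves \<Gamma> B"
| gen: "proves \<Gamma> A \<Longrightarrow> proves \<Gamma> (Forall A)"

definition consistent :: "fm set \<Rightarrow> bool" where
  "consistent T = (\<not> proves T Fls)"

section \<open>Elementary Arithmetic EA = I\<Delta>0 + Exp (in the language with 2^x)\<close>

definition indF :: "fm \<Rightarrow> fm" where
  "indF A = Imp (Conj (inst A Zr) (Forall (Imp A (substF 0 (Sc (Var 0)) (liftF 1 A))))) (Forall A)"

inductive_set EA :: "fm set" where
  "close 1 (Neg (Eqt (Sc (Var 0)) Zr)) \<in> EA"
| "close 2 (Imp (Eqt (Sc (Var 1)) (Sc (Var 0))) (Eqt (Var 1) (Var 0))) \<in> EA"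
| "close 1 (Eqt (Pl (Var 0) Zr) (Var 0)) \<in> EA"
| "close 2 (Eqt (Pl (Var 1) (Sc (Var 0))) (Sc (Pl (Var 1) (Var 0)))) \<in> EA"
| "close 1 (Eqt (Tm (Var 0) Zr) Zr) \<in> EA"
| "close 2 (Eqt (Tm (Var 1) (Sc (Var 0))) (Pl (Tm (Var 1) (Var 0)) (Var 1))) \<in> EA"
| "close 2 (Iff (Leq (Var 1) (Var 0)) (Exists (Eqt (Pl (Var 0) (Var 2)) (Var 1)))) \<in> EA"
| "Eqt (Ex2 Zr) (Sc Zr) \<in> EA"
| "close 1 (Eqt (Ex2 (Sc (Var 0))) (Pl (Ex2 (Var 0)) (Ex2 (Var 0)))) \<in> EA"
| "Delta0 A \<Longrightarrow> closedF (Suc n) A \<Longrightarrow> close n (indF A) \<in> EA"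

definition ce_theory :: "fm set \<Rightarrow> bool" where
  "ce_theory U = (\<exists>\<sigma>. Sigma1 \<sigma> \<and> closedF 1 \<sigma> \<and>
      (\<forall>n. n \<in> codeF ` U \<longleftrightarrow> evalF (\<lambda>_. 0) (inst \<sigma> (num n))))"

definition extends_EA :: "fm set \<Rightarrow> bool" where
  "extends_EA U = (\<forall>A\<in>EA. proves U A)"

end

theory Submission
  imports Defs
begin

text \<open>
  The formula is a Rosser sentence played by equivalence classes. At stage \<open>s\<close>, a code \<open>x \<le> s\<close> is
  identified with every code that the \<open>U\<close>-proofs of equivalences found up to \<open>s\<close> connect to it.
  Stage \<open>s\<close> is positive for \<open>x\<close> if some \<open>c\<close> in its class has by then been found with
  \<open>U \<turnstile> c \<rightarrow> \<rho>(c)\<close>, and negative if some \<open>c\<close> has been found with \<open>U \<turnstile> c \<rightarrow> \<not>\<rho>(c)\<close>; and \<open>\<rho>(x)\<close> says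
  that no positive stage comes strictly before all negative ones.

  If \<open>U + \<phi>\<close> is consistent, no actual number is a positive or negative stage for \<open>\<phi>\<close>: at the least
  stage for any member of the \<open>U\<close>-class of \<open>\<phi>\<close>, the responsible \<open>c\<close> itself has that stage, so \<open>EA\<close>
  decides \<open>\<rho>(c)\<close> against the proof found, and \<open>U\<close> refutes \<open>c\<close>. This gives independence. If moreover
  \<open>U \<turnstile> \<phi> \<leftrightarrow> \<psi>\<close>, the two codes are identified from some actual stage \<open>n\<close> on; below \<open>n\<close> nothing happens
  to either, which is a true bounded statement, and from \<open>n\<close> on they behave alike by pure logic.

  Classes are described by quantifying over all finite sets closed under the equivalences found so
  far, so that \<open>EA\<close> need not prove anything about them; and self-reference is obtained by applying a
  formula to its own numeral, the coded syntax being needed only in the standard model.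
\<close>

section \<open>Parallel substitution\<close>

text \<open>Lifting and single substitution are both simultaneous substitutions, and these compose
  pointwise. The de Bruijn commutation laws then become equalities of functions on
  variables.\<close>

fun psubT :: "(nat \<Rightarrow> trm) \<Rightarrow> trm \<Rightarrow> trm" where
  "psubT \<sigma> (Var i) = \<sigma> i"
| "psubT \<sigma> Zr = Zr"
| "psubT \<sigma> (Sc t) = Sc (psubT \<sigma> t)"
| "psubT \<sigma> (Pl t s) = Pl (psubT \<sigma> t) (psubT \<sigma> s)"
| "psubT \<sigma> (Tm t s) = Tm (psubT \<sigma> t) (psubT \<sigma> s)"
| "psubT \<sigma> (Ex2 t) = Ex2 (psubT \<sigma> t)"

definition up :: "(nat \<Rightarrow> trm) \<Rightarrow> nat \<Rightarrow> trm" where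
  "up \<sigma> = case_nat (Var 0) (\<lambda>i. liftT 0 (\<sigma> i))"

fun psubF :: "(nat \<Rightarrow> trm) \<Rightarrow> fm \<Rightarrow> fm" where
  "psubF \<sigma> Fls = Fls"
| "psubF \<sigma> (Eqt t s) = Eqt (psubT \<sigma> t) (psubT \<sigma> s)"
| "psubF \<sigma> (Leq t s) = Leq (psubT \<sigma> t) (psubT \<sigma> s)"
| "psubF \<sigma> (Imp A B) = Imp (psubF \<sigma> A) (psubF \<sigma> B)"
| "psubF \<sigma> (Forall A) = Forall (psubF (up \<sigma>) A)"

definition lift_var :: "nat \<Rightarrow> nat \<Rightarrow> trm" where
  "lift_var k i = Var (if i < k then i else Suc i)"

definition subst_var :: "nat \<Rightarrow> trm \<Rightarrow> nat \<Rightarrow> trm" where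
  "subst_var k u i = (if i < k then Var i else if i = k then u else Var (i - 1))"

lemma up_0 [simp]: "up \<sigma> 0 = Var 0" and up_Suc [simp]: "up \<sigma> (Suc i) = liftT 0 (\<sigma> i)"
  by (simp_all add: up_def)

lemma psubT_psubT [simp]: "psubT \<sigma> (psubT \<tau> t) = psubT (\<lambda>i. psubT \<sigma> (\<tau> i)) t"
  by (induction t) auto

lemma liftT_eq_psubT: "liftT k t = psubT (lift_var k) t"
  by (induction t) (auto simp: lift_var_def)

lemma substT_eq_psubT: "substT k u t = psubT (subst_var k u) t"
  by (induction t) (auto simp: subst_var_def)

lemma psubT_Var [simp]: "psubT Var t = t"
  by (induction t) auto

lemma up_lift_var: "up (lift_var k) = lift_var (Suc k)"
  by (auto simp: up_def lift_var_def split: nat.splits)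

lemma up_subst_var: "up (subst_var k u) = subst_var (Suc k) (liftT 0 u)"
  by (auto simp: up_def subst_var_def split: nat.splits)

lemma up_Var [simp]: "up Var = Var"
  by (auto simp: up_def split: nat.splits)

lemma liftF_eq_psubF: "liftF k A = psubF (lift_var k) A"
  by (induction A arbitrary: k) (auto simp: liftT_eq_psubT up_lift_var)

lemma substF_eq_psubF: "substF k u A = psubF (subst_var k u) A"
  by (induction A arbitrary: k u) (auto simp: substT_eq_psubT up_subst_var)

lemma lift_var_0: "lift_var 0 = (\<lambda>i. Var (Suc i))"
  by (auto simp: lift_var_def)

lemma subst_var_0: "subst_var 0 u = case_nat u Var"
  by (auto simp: subst_var_def split: nat.splits)

lemma liftT_0: "liftT 0 t = psubT (\<lambda>i. Var (Suc i)) t"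
  by (simp add: liftT_eq_psubT lift_var_0)

lemma liftF_0: "liftF 0 A = psubF (\<lambda>i. Var (Suc i)) A"
  by (simp add: liftF_eq_psubF lift_var_0)

lemma inst_eq_psubF: "inst A t = psubF (case_nat t Var) A"
  by (simp add: inst_def substF_eq_psubF subst_var_0)

lemma psubT_up_liftT [simp]: "psubT (up \<sigma>) (liftT 0 t) = liftT 0 (psubT \<sigma> t)"
  by (simp add: liftT_0)

lemma up_comp: "(\<lambda>i. psubT (up \<sigma>) (up \<tau> i)) = up (\<lambda>i. psubT \<sigma> (\<tau> i))"
  by (rule ext) (simp add: up_def[of \<tau>] up_def[of "\<lambda>i. psubT \<sigma> (\<tau> i)"] split: nat.splits)

lemma psubF_psubF [simp]: "psubF \<sigma> (psubF \<tau> A) = psubF (\<lambda>i. psubT \<sigma> (\<tau> i)) A"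
  by (induction A arbitrary: \<sigma> \<tau>) (auto simp: up_comp)

lemma psubF_Var [simp]: "psubF Var A = A"
  by (induction A) auto

lemma psubT_case_nat_liftT [simp]: "psubT (case_nat u \<sigma>) (liftT 0 t) = psubT \<sigma> t"
  by (simp add: liftT_0)

lemma psubF_case_nat_liftF [simp]: "psubF (case_nat u \<sigma>) (liftF 0 A) = psubF \<sigma> A"
  by (simp add: liftF_0)

text \<open>Lets \<open>proves_psubF\<close> see that substitution carries instances of
  \<open>axInst\<close> and \<open>axLeib\<close> to instances of the same schemes.\<close>

lemma psubF_inst: "psubF \<sigma> (inst A t) = inst (psubF (up \<sigma>) A) (psubT \<sigma> t)"
proof -
  have "(\<lambda>i. psubT \<sigma> (case i of 0 \<Rightarrow> t | Suc x \<Rightarrow> Var x)) =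
        (\<lambda>i. psubT (case_nat (psubT \<sigma> t) Var) (up \<sigma> i))"
    by (auto simp: up_def split: nat.splits)
  then show ?thesis by (simp add: inst_eq_psubF)
qed

lemma psubF_liftF: "psubF (up \<sigma>) (liftF 0 A) = liftF 0 (psubF \<sigma> A)"
  by (simp add: liftF_0) (simp add: liftT_0)

lemma psubF_Neg [simp]: "psubF \<sigma> (Neg A) = Neg (psubF \<sigma> A)"
  and psubF_Conj [simp]: "psubF \<sigma> (Conj A B) = Conj (psubF \<sigma> A) (psubF \<sigma> B)"
  and psubF_Disj [simp]: "psubF \<sigma> (Disj A B) = Disj (psubF \<sigma> A) (psubF \<sigma> B)"
  and psubF_Iff [simp]: "psubF \<sigma> (Iff A B) = Iff (psubF \<sigma> A) (psubF \<sigma> B)"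
  and psubF_Exists [simp]: "psubF \<sigma> (Exists A) = Exists (psubF (up \<sigma>) A)"
  by (simp_all add: Neg_def Conj_def Disj_def Iff_def Exists_def)

lemma psubT_num [simp]: "psubT \<sigma> (num n) = num n"
  by (induction n) auto

lemma liftT_num [simp]: "liftT k (num n) = num n"
  by (induction n) auto

lemma closedT_num [simp]: "closedT k (num n)"
  by (induction n) auto

lemma evalT_num [simp]: "evalT e (num n) = n"
  by (induction n) auto

lemma psubT_cong_closed: "closedT n t \<Longrightarrow> (\<And>i. i < n \<Longrightarrow> \<sigma> i = \<tau> i) \<Longrightarrow> psubT \<sigma> t = psubT \<tau> t"
  by (induction t) auto

lemma psubF_cong_closed: "closedF n A \<Longrightarrow> (\<And>i. i < n \<Longrightarrow> \<sigma> i = \<tau> i) \<Longrightarrow> psubF \<sigma> A = psubF \<tau> A"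
proof (induction A arbitrary: n \<sigma> \<tau>)
  case (Forall A)
  have "psubF (up \<sigma>) A = psubF (up \<tau>) A"
    by (rule Forall.IH[of "Suc n"]) (use Forall.prems in \<open>auto simp: up_def split: nat.splits\<close>)
  then show ?case by simp
next
  case (Imp A B)
  from Imp.IH(1)[of n \<sigma> \<tau>] Imp.IH(2)[of n \<sigma> \<tau>] Imp.prems show ?case by simp
next
  case (Eqt t s)
  from psubT_cong_closed[of n t \<sigma> \<tau>] psubT_cong_closed[of n s \<sigma> \<tau>] Eqt.prems show ?case by simp
next
  case (Leq t s)
  from psubT_cong_closed[of n t \<sigma> \<tau>] psubT_cong_closed[of n s \<sigma> \<tau>] Leq.prems show ?case by simp
qed simp

lemma psubF_sentence: "sentence A \<Longrightarrow> psubF \<sigma> A = A"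
  using psubF_cong_closed[of 0 A \<sigma> Var] by (simp add: sentence_def)

lemma closedT_psubT: "closedT n t \<Longrightarrow> (\<And>i. i < n \<Longrightarrow> closedT m (\<sigma> i)) \<Longrightarrow> closedT m (psubT \<sigma> t)"
  by (induction t) auto

lemma closedT_liftT: "closedT n t \<Longrightarrow> closedT (Suc n) (liftT 0 t)"
  by (simp add: liftT_0 closedT_psubT)

lemma closedF_psubF: "closedF n A \<Longrightarrow> (\<And>i. i < n \<Longrightarrow> closedT m (\<sigma> i)) \<Longrightarrow> closedF m (psubF \<sigma> A)"
proof (induction A arbitrary: n m \<sigma>)
  case (Forall A)
  have "closedF (Suc m) (psubF (up \<sigma>) A)"
    by (rule Forall.IH[of "Suc n"])
      (use Forall.prems in \<open>auto simp: up_def closedT_liftT split: nat.splits\<close>)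
  then show ?case by simp
next
  case (Imp A B)
  from Imp.IH(1)[of n m \<sigma>] Imp.IH(2)[of n m \<sigma>] Imp.prems show ?case by simp
next
  case (Eqt t s)
  from closedT_psubT[of n t m \<sigma>] closedT_psubT[of n s m \<sigma>] Eqt.prems show ?case by simp
next
  case (Leq t s)
  from closedT_psubT[of n t m \<sigma>] closedT_psubT[of n s m \<sigma>] Leq.prems show ?case by simp
qed simp

lemma closedF_Neg [simp]: "closedF n (Neg A) = closedF n A"
  and closedF_Conj [simp]: "closedF n (Conj A B) = (closedF n A \<and> closedF n B)"
  and closedF_Disj [simp]: "closedF n (Disj A B) = (closedF n A \<and> closedF n B)"
  and closedF_Iff [simp]: "closedF n (Iff A B) = (closedF n A \<and> closedF n B)"
  and closedF_Exists [simp]: "closedF n (Exists A) = closedF (Suc n) A"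
  by (auto simp: Neg_def Conj_def Disj_def Iff_def Exists_def)

lemma evalT_psubT: "evalT e (psubT \<sigma> t) = evalT (\<lambda>i. evalT e (\<sigma> i)) t"
  by (induction t) auto

lemma evalT_liftT [simp]: "evalT (case_nat n e) (liftT 0 t) = evalT e t"
  by (simp add: liftT_0 evalT_psubT)

lemma evalF_psubF: "evalF e (psubF \<sigma> A) = evalF (\<lambda>i. evalT e (\<sigma> i)) A"
proof (induction A arbitrary: e \<sigma>)
  case (Forall A)
  have "(\<lambda>i. evalT (case_nat n e) (up \<sigma> i)) = case_nat n (\<lambda>i. evalT e (\<sigma> i))" for n
    by (auto simp: up_def split: nat.splits)
  then show ?case by (simp add: Forall.IH)
qed (auto simp: evalT_psubT)

lemma evalT_cong_closed: "closedT n t \<Longrightarrow> (\<And>i. i < n \<Longrightarrow> e i = e' i) \<Longrightarrow> evalT e t = evalT e' t"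
  by (induction t) auto

lemma evalF_cong_closed: "closedF n A \<Longrightarrow> (\<And>i. i < n \<Longrightarrow> e i = e' i) \<Longrightarrow> evalF e A = evalF e' A"
proof (induction A arbitrary: n e e')
  case (Forall A)
  have "evalF (case_nat m e) A = evalF (case_nat m e') A" for m
    by (rule Forall.IH[of "Suc n"]) (use Forall.prems in \<open>auto split: nat.splits\<close>)
  then show ?case by simp
next
  case (Imp A B)
  from Imp.IH(1)[of n e e'] Imp.IH(2)[of n e e'] Imp.prems show ?case by simp
next
  case (Eqt t s)
  from evalT_cong_closed[of n t e e'] evalT_cong_closed[of n s e e'] Eqt.prems show ?case by simp
next
  case (Leq t s)
  from evalT_cong_closed[of n t e e'] evalT_cong_closed[of n s e e'] Leq.prems show ?case by simp
qed simp

lemma evalF_Neg [simp]: "evalF e (Neg A) = (\<not> evalF e A)"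
  and evalF_Conj [simp]: "evalF e (Conj A B) = (evalF e A \<and> evalF e B)"
  and evalF_Disj [simp]: "evalF e (Disj A B) = (evalF e A \<or> evalF e B)"
  and evalF_Exists [simp]: "evalF e (Exists A) = (\<exists>n. evalF (case_nat n e) A)"
  by (auto simp: Neg_def Conj_def Disj_def Iff_def Exists_def)

section \<open>Bounded quantifiers\<close>

definition BAll :: "trm \<Rightarrow> fm \<Rightarrow> fm" where
  "BAll t A = Forall (Imp (Leq (Var 0) (liftT 0 t)) A)"

definition BEx :: "trm \<Rightarrow> fm \<Rightarrow> fm" where
  "BEx t A = Neg (BAll t (Neg A))"

lemma psubF_BAll [simp]: "psubF \<sigma> (BAll t A) = BAll (psubT \<sigma> t) (psubF (up \<sigma>) A)"
  and psubF_BEx [simp]: "psubF \<sigma> (BEx t A) = BEx (psubT \<sigma> t) (psubF (up \<sigma>) A)"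
  by (simp_all add: BAll_def BEx_def)

lemma evalF_BAll [simp]: "evalF e (BAll t A) = (\<forall>n \<le> evalT e t. evalF (case_nat n e) A)"
  and evalF_BEx [simp]: "evalF e (BEx t A) = (\<exists>n \<le> evalT e t. evalF (case_nat n e) A)"
  by (auto simp: BAll_def BEx_def)

lemma closedF_BAll [simp]: "closedF n (BAll t A) \<longleftrightarrow> closedT (Suc n) (liftT 0 t) \<and> closedF (Suc n) A"
  and closedF_BEx [simp]: "closedF n (BEx t A) \<longleftrightarrow> closedT (Suc n) (liftT 0 t) \<and> closedF (Suc n) A"
  by (auto simp: BAll_def BEx_def)

lemma Delta0_BAll [intro]: "Delta0 A \<Longrightarrow> Delta0 (BAll t A)"
  by (auto simp: BAll_def intro: Delta0.intros)

lemma Delta0_Neg [intro]: "Delta0 A \<Longrightarrow> Delta0 (Neg A)"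
  by (auto simp: Neg_def intro: Delta0.intros)

lemma Delta0_Conj [intro]: "Delta0 A \<Longrightarrow> Delta0 B \<Longrightarrow> Delta0 (Conj A B)"
  by (auto simp: Conj_def intro: Delta0.intros)

lemma Delta0_Disj [intro]: "Delta0 A \<Longrightarrow> Delta0 B \<Longrightarrow> Delta0 (Disj A B)"
  by (auto simp: Disj_def intro: Delta0.intros)

lemma Delta0_BEx [intro]: "Delta0 A \<Longrightarrow> Delta0 (BEx t A)"
  by (auto simp: BEx_def)

lemma Delta0_psubF: "Delta0 A \<Longrightarrow> Delta0 (psubF \<sigma> A)"
  by (induction A arbitrary: \<sigma> rule: Delta0.induct) (auto intro: Delta0.intros)

section \<open>Propositional reasoning in the calculus\<close>

text \<open>Truth under a propositional valuation: equations, inequalities and quantified formulas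
  all count as atoms, so that consequence in this sense is tautological consequence.\<close>

fun holds :: "(fm \<Rightarrow> bool) \<Rightarrow> fm \<Rightarrow> bool" where
  "holds v Fls = False"
| "holds v (Imp A B) = (holds v A \<longrightarrow> holds v B)"
| "holds v (Eqt t s) = v (Eqt t s)"
| "holds v (Leq t s) = v (Leq t s)"
| "holds v (Forall A) = v (Forall A)"

lemma holds_Neg [simp]: "holds v (Neg A) = (\<not> holds v A)"
  and holds_Conj [simp]: "holds v (Conj A B) = (holds v A \<and> holds v B)"
  and holds_Disj [simp]: "holds v (Disj A B) = (holds v A \<or> holds v B)"
  and holds_Iff [simp]: "holds v (Iff A B) = (holds v A \<longleftrightarrow> holds v B)"
  and holds_BEx: "holds v (BEx t A) = (\<not> holds v (BAll t (Neg A)))"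
  and holds_Exists: "holds v (Exists A) = (\<not> holds v (Forall (Neg A)))"
  by (auto simp: Neg_def Conj_def Disj_def Iff_def BEx_def Exists_def)

text \<open>Closure under generalisation is left out on purpose: it would be lost when an arbitrary
  formula is added together with its propositional consequences.\<close>

definition mp_closed :: "fm set \<Rightarrow> bool" where
  "mp_closed S \<longleftrightarrow> (\<forall>A B C. Imp A (Imp B A) \<in> S \<and> Imp (Imp A (Imp B C)) (Imp (Imp A B) (Imp A C)) \<in> S
     \<and> Imp (Imp (Imp A Fls) Fls) A \<in> S) \<and> (\<forall>A B. Imp A B \<in> S \<longrightarrow> A \<in> S \<longrightarrow> B \<in> S)"

text \<open>The propositional deduction theorem: \<open>{B. Imp A B \<in> S}\<close> is what modus
  ponens yields from \<open>S\<close> and \<open>A\<close>. The scheme \<open>axK\<close> puts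
  \<open>S\<close> inside it, and \<open>axS\<close> makes it closed.\<close>

lemma mp_closed_extend:
  assumes "mp_closed S"
  shows "mp_closed {B. Imp A B \<in> S}" and "S \<subseteq> {B. Imp A B \<in> S}" and "Imp A A \<in> S"
proof -
  have K: "Imp A (Imp B A) \<in> S" and S: "Imp (Imp A (Imp B C)) (Imp (Imp A B) (Imp A C)) \<in> S"
    and DN: "Imp (Imp (Imp A Fls) Fls) A \<in> S"
    and mp: "Imp A B \<in> S \<Longrightarrow> A \<in> S \<Longrightarrow> B \<in> S" for A B C
    using assms unfolding mp_closed_def by blast+
  have *: "B \<in> S \<Longrightarrow> Imp A B \<in> S" for B by (rule mp[OF K])
  then show "S \<subseteq> {B. Imp A B \<in> S}" by blast
  show "Imp A A \<in> S" using mp[OF mp[OF S[of A "Imp A A" A] K] K] .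
  have "Imp A C \<in> S" if "Imp A (Imp B C) \<in> S" "Imp A B \<in> S" for B C
    using mp[OF mp[OF S that(1)] that(2)] .
  then show "mp_closed {B. Imp A B \<in> S}"
    unfolding mp_closed_def by (simp add: * K S DN)
qed

text \<open>A maximal deductively closed set avoiding a non-theorem is the truth set of a valuation.\<close>

lemma mp_closed_separation:
  assumes S: "mp_closed S" and C: "C \<notin> S"
  obtains v where "\<forall>A \<in> S. holds v A" "\<not> holds v C"
proof -
  define F where "F = {M. mp_closed M \<and> S \<subseteq> M \<and> C \<notin> M}"
  have "\<exists>M\<in>F. \<forall>X\<in>F. M \<subseteq> X \<longrightarrow> X = M"
  proof (rule subset_Zorn)
    fix \<C> assume ch: "subset.chain F \<C>"
    show "\<exists>M\<in>F. \<forall>X\<in>\<C>. X \<subseteq> M" 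
    proof (cases "\<C> = {}")
      case True
      then show ?thesis using S C unfolding F_def by blast
    next
      case False
      have "mp_closed (\<Union>\<C>)"
      proof -
        have "B \<in> \<Union>\<C>" if AB: "Imp A B \<in> \<Union>\<C>" "A \<in> \<Union>\<C>" for A B
        proof -
          obtain X Y where "X \<in> \<C>" "Imp A B \<in> X" "Y \<in> \<C>" "A \<in> Y" using AB by blast
          moreover from this have "X \<subseteq> Y \<or> Y \<subseteq> X" using ch unfolding subset.chain_def by blast
          ultimately obtain Z where "Z \<in> \<C>" "Imp A B \<in> Z" "A \<in> Z" by blast
          moreover have "mp_closed Z" using \<open>Z \<in> \<C>\<close> ch unfolding subset.chain_def F_def by blast
          ultimately show ?thesis unfolding mp_closed_def by blast
        qed
        moreover obtain X where "X \<in> \<C>" using False by blast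
        moreover have "mp_closed X" using \<open>X \<in> \<C>\<close> ch unfolding subset.chain_def F_def by blast
        ultimately show ?thesis unfolding mp_closed_def by blast
      qed
      moreover have "S \<subseteq> \<Union>\<C>" "C \<notin> \<Union>\<C>" using False ch unfolding subset.chain_def F_def by blast+
      ultimately show ?thesis unfolding F_def by blast
    qed
  qed
  then obtain M where M: "mp_closed M" "S \<subseteq> M" "C \<notin> M"
    and max: "\<And>X. mp_closed X \<Longrightarrow> C \<notin> X \<Longrightarrow> M \<subseteq> X \<Longrightarrow> X = M"
    unfolding F_def by (auto dest: subset_trans)
  have K: "Imp A (Imp B A) \<in> M" and SS: "Imp (Imp A (Imp B C)) (Imp (Imp A B) (Imp A C)) \<in> M"
    and DN: "Imp (Imp (Imp A Fls) Fls) A \<in> M"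
    and mp: "Imp A B \<in> M \<Longrightarrow> A \<in> M \<Longrightarrow> B \<in> M" for A B C
    using M(1) unfolding mp_closed_def by blast+
  have dist: "Imp A C \<in> M" if "Imp A (Imp B C) \<in> M" "Imp A B \<in> M" for A B C
    using mp[OF mp[OF SS that(1)] that(2)] .
  have wk: "B \<in> M \<Longrightarrow> Imp A B \<in> M" for A B by (rule mp[OF K])
  \<comment> \<open>If \<open>A\<close> is outside \<open>M\<close>, the extension of
    \<open>M\<close> by \<open>A\<close> is strictly larger, so by maximality it contains
    \<open>C\<close>.\<close>
  have non: "Imp A C \<in> M" if "A \<notin> M" for A
    using max[OF mp_closed_extend(1)[OF M(1), of A]] mp_closed_extend(2,3)[OF M(1), of A] that by blast
  have fls: "Fls \<notin> M"
    using M(3) mp[OF DN[of C] wk] by blast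
  \<comment> \<open>If \<open>M\<close> contained neither \<open>A\<close> nor its negation, both
    would imply \<open>C\<close> in \<open>M\<close>, and \<open>C\<close> would follow
    classically.\<close>
  have neg: "Imp A Fls \<in> M" if "A \<notin> M" for A
  proof (rule ccontr)
    assume n: "Imp A Fls \<notin> M"
    have "Imp (Imp C Fls) (Imp A (Imp C Fls)) \<in> M" by (rule K)
    moreover have "Imp (Imp A (Imp C Fls)) (Imp A Fls) \<in> M"
      by (rule dist[OF SS wk[OF non[OF that]]])
    ultimately have *: "Imp (Imp C Fls) (Imp A Fls) \<in> M" by (rule dist[OF wk, rotated])
    have "Imp (Imp C Fls) C \<in> M"
    proof -
      have "Imp (Imp C Fls) (Imp (Imp A Fls) C) \<in> M" using wk[OF non[OF n]] .
      then show ?thesis using * by (rule dist)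
    qed
    then have "Imp (Imp C Fls) Fls \<in> M" by (rule dist[OF mp_closed_extend(3)[OF M(1)]])
    then show False using mp[OF DN] M(3) by blast
  qed
  have fls_imp: "Imp Fls B \<in> M" for B
    by (rule dist[OF wk[OF DN] K])
  have imp: "Imp A B \<in> M \<longleftrightarrow> (A \<in> M \<longrightarrow> B \<in> M)" for A B
    using mp[of A B] wk[of B A] neg[of A] dist[OF wk[OF fls_imp[of B]], of A] by blast
  have "holds (\<lambda>A. A \<in> M) A = (A \<in> M)" for A
    by (induction A) (auto simp: imp fls)
  then show ?thesis using that[of "\<lambda>A. A \<in> M"] M by blast
qed

lemma mp_closed_theorems: "mp_closed {A. proves T A}"
  unfolding mp_closed_def by (auto simp: axK axS axDN dest: mp)

text \<open>Propositional completeness of the calculus: an unprovable formula is false under some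
  valuation that makes all theorems true. From here on propositional inferences are checked by
  evaluating \<open>holds\<close>, in the forms \<open>taut0\<close> to
  \<open>taut4\<close>.\<close>

lemma tautological_consequence:
  assumes "\<And>v. \<forall>A \<in> set As. holds v A \<Longrightarrow> holds v C" and "\<forall>A \<in> set As. proves T A"
  shows "proves T C"
proof (rule ccontr)
  assume "\<not> proves T C"
  then obtain v where "\<forall>A \<in> {A. proves T A}. holds v A" "\<not> holds v C"
    using mp_closed_separation[OF mp_closed_theorems, of C T] by blast
  then show False using assms by blast
qed

lemma taut0: "(\<And>v. holds v C) \<Longrightarrow> proves T C"
  using tautological_consequence[of "[]" C T] by simp

lemma taut1: "proves T A \<Longrightarrow> (\<And>v. holds v A \<Longrightarrow> holds v C) \<Longrightarrow> proves T C"
  using tautological_consequence[of "[A]" C T] by simp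

lemma taut2: "proves T A \<Longrightarrow> proves T B \<Longrightarrow> (\<And>v. holds v A \<Longrightarrow> holds v B \<Longrightarrow> holds v C) \<Longrightarrow> proves T C"
  using tautological_consequence[of "[A,B]" C T] by simp

lemma taut3: "proves T A \<Longrightarrow> proves T B \<Longrightarrow> proves T D
    \<Longrightarrow> (\<And>v. holds v A \<Longrightarrow> holds v B \<Longrightarrow> holds v D \<Longrightarrow> holds v C) \<Longrightarrow> proves T C"
  using tautological_consequence[of "[A,B,D]" C T] by simp

lemma taut4: "proves T A \<Longrightarrow> proves T B \<Longrightarrow> proves T D \<Longrightarrow> proves T E
    \<Longrightarrow> (\<And>v. holds v A \<Longrightarrow> holds v B \<Longrightarrow> holds v D \<Longrightarrow> holds v E \<Longrightarrow> holds v C) \<Longrightarrow> proves T C"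
  using tautological_consequence[of "[A,B,D,E]" C T] by simp

text \<open>Hypotheses are sentences, hence unchanged, and every scheme and rule is stable under
  substitution. The substitution stays arbitrary in the induction because generalisation passes to
  \<open>up\<close>.\<close>

lemma proves_psubF:
  assumes "proves T A" and "\<forall>A \<in> T. sentence A"
  shows "proves T (psubF \<sigma> A)"
  using assms
proof (induction arbitrary: \<sigma> rule: proves.induct)
  case (hyp A \<Gamma>)
  then show ?case by (simp add: psubF_sentence proves.hyp)
next
  case (mp \<Gamma> A B)
  show ?case
    by (rule proves.mp[of _ "psubF \<sigma> A"]) (use mp.IH[OF mp.prems, of \<sigma>] in simp_all)
next
  case (gen \<Gamma> A)
  show ?case by (simp, rule proves.gen, rule gen.IH, rule gen.prems)
next
  case (axInst \<Gamma> A t)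
  show ?case by (simp only: psubF.simps psubF_inst proves.axInst)
next
  case (axLeib \<Gamma> t s A)
  show ?case by (simp only: psubF.simps psubF_inst proves.axLeib)
next
  case (axAllImp \<Gamma> A B)
  show ?case unfolding psubF.simps psubF_liftF by (rule proves.axAllImp)
next
  case axK show ?case by (simp, rule proves.axK)
next
  case axS show ?case by (simp, rule proves.axS)
next
  case axDN show ?case by (simp, rule proves.axDN)
next
  case axRefl show ?case by (simp, rule proves.axRefl)
qed

section \<open>Arithmetic in EA and decidability of bounded sentences\<close>

lemma closedF_close: "closedF m (close n A) = closedF (m + n) A"
  by (induction n arbitrary: m) auto

lemma closedF_indF: "closedF (Suc n) A \<Longrightarrow> closedF n (indF A)"
  unfolding indF_def inst_eq_psubF substF_eq_psubF liftF_eq_psubF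
  by (auto simp: subst_var_def lift_var_def split: nat.splits intro!: closedF_psubF[of "Suc n"])

lemma EA_sentences: "\<forall>A \<in> EA. sentence A"
proof
  fix A assume "A \<in> EA" then show "sentence A"
    by cases (auto simp: sentence_def closedF_close closedF_indF numeral_2_eq_2)
qed

text \<open>Instantiating at a term lowers the indices of the other free variables. The theorem is
  therefore shifted up by one first, and its instance at \<open>Var 0\<close> is exactly
  \<open>A\<close>.\<close>

lemma proves_ForallD:
  assumes "\<forall>A \<in> T. sentence A" and "proves T (Forall A)"
  shows "proves T A"
proof -
  let ?B = "psubF (up (\<lambda>i. Var (Suc i))) A"
  have "proves T (Forall ?B)" using proves_psubF[OF assms(2,1), of "\<lambda>i. Var (Suc i)"] by simp
  then have "proves T (inst ?B (Var 0))" using axInst mp by blast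
  moreover have "(\<lambda>i. psubT (case_nat (Var 0) Var) (up (\<lambda>i. Var (Suc i)) i)) = Var"
    by (auto simp: up_def split: nat.splits)
  ultimately show ?thesis by (simp add: inst_eq_psubF)
qed

lemma proves_closeD: "\<forall>A \<in> T. sentence A \<Longrightarrow> proves T (close n A) \<Longrightarrow> proves T A"
  by (induction n) (auto dest: proves_ForallD)

text \<open>\<open>extends_EA\<close> asks that \<open>U\<close> prove the axioms of EA rather than
  contain them, so each axiom in an EA-proof is replaced by its derivation in
  \<open>U\<close>.\<close>

lemma proves_cut: "proves T A \<Longrightarrow> \<forall>B \<in> T. proves S B \<Longrightarrow> proves S A"
proof (induction rule: proves.induct)
  case (mp \<Gamma> A B)
  then show ?case using proves.mp by blast
next
  case (axInst \<Gamma> A t)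
  show ?case by (rule proves.axInst)
qed (simp_all add: axK axS axDN axAllImp axRefl axLeib proves.gen)

section \<open>The axioms of EA for arbitrary terms\<close>

lemma EA_psubF: "proves EA A \<Longrightarrow> proves EA (psubF \<sigma> A)"
  using proves_psubF EA_sentences by blast

lemma EA_axiom: "close n A \<in> EA \<Longrightarrow> proves EA (psubF \<sigma> A)"
  using EA_psubF proves_closeD[OF EA_sentences] proves.hyp by blast

lemma EA_Sc_neq_Zr: "proves EA (Neg (Eqt (Sc t) Zr))"
  using EA_axiom[OF EA.intros(1), of "case_nat t Var"] by simp

lemma EA_Sc_inj: "proves EA (Imp (Eqt (Sc t) (Sc s)) (Eqt t s))"
  using EA_axiom[OF EA.intros(2), of "case_nat s (case_nat t Var)"] by simp

lemma EA_Pl_Zr: "proves EA (Eqt (Pl t Zr) t)"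
  using EA_axiom[OF EA.intros(3), of "case_nat t Var"] by simp

lemma EA_Pl_Sc: "proves EA (Eqt (Pl t (Sc s)) (Sc (Pl t s)))"
  using EA_axiom[OF EA.intros(4), of "case_nat s (case_nat t Var)"] by simp

lemma EA_Tm_Zr: "proves EA (Eqt (Tm t Zr) Zr)"
  using EA_axiom[OF EA.intros(5), of "case_nat t Var"] by simp

lemma EA_Tm_Sc: "proves EA (Eqt (Tm t (Sc s)) (Pl (Tm t s) t))"
  using EA_axiom[OF EA.intros(6), of "case_nat s (case_nat t Var)"] by simp

lemma EA_Leq: "proves EA (Iff (Leq t s) (Exists (Eqt (Pl (Var 0) (liftT 0 t)) (liftT 0 s))))"
  using EA_axiom[OF EA.intros(7), of "case_nat s (case_nat t Var)"] by (simp add: numeral_2_eq_2)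

lemma EA_Ex2_Zr: "proves EA (Eqt (Ex2 Zr) (Sc Zr))"
  by (rule proves.hyp, rule EA.intros)

lemma EA_Ex2_Sc: "proves EA (Eqt (Ex2 (Sc t)) (Pl (Ex2 t) (Ex2 t)))"
  using EA_axiom[OF EA.intros(9), of "case_nat t Var"] by simp

text \<open>Induction without parameters, where the axiom has no closing quantifiers. It serves
  \<open>EA_one_Pl\<close> and \<open>EA_zero_or_Sc\<close>; all other inductions below run outside
  EA.\<close>

lemma EA_induct:
  assumes "Delta0 A" "closedF 1 A" and "proves EA (psubF (case_nat Zr Var) A)"
    and "proves EA (Imp A (psubF (case_nat (Sc (Var 0)) (\<lambda>i. Var (Suc i))) A))"
  shows "proves EA A"
proof -
  have "(\<lambda>i. psubT (subst_var 0 (Sc (Var 0))) (lift_var 1 i)) = case_nat (Sc (Var 0)) (\<lambda>i. Var (Suc i))"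
    by (auto simp: subst_var_def lift_var_def split: nat.splits)
  then have "substF 0 (Sc (Var 0)) (liftF 1 A) = psubF (case_nat (Sc (Var 0)) (\<lambda>i. Var (Suc i))) A"
    by (simp add: substF_eq_psubF liftF_eq_psubF)
  moreover have "proves EA (indF A)"
    using EA.intros(10)[of A 0] assms(1,2) by (auto intro: proves.hyp)
  ultimately have "proves EA (Imp (Conj (psubF (case_nat Zr Var) A)
      (Forall (Imp A (psubF (case_nat (Sc (Var 0)) (\<lambda>i. Var (Suc i))) A)))) (Forall A))"
    by (simp add: indF_def inst_eq_psubF)
  then have "proves EA (Forall A)"
    by (rule taut3[OF _ assms(3) proves.gen[OF assms(4)]]) simp
  then show ?thesis by (rule proves_ForallD[OF EA_sentences])
qed

section \<open>Equality\<close>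

lemma eq_replaceF: "proves T (Imp (Eqt t s) (Imp (psubF (case_nat t Var) A) (psubF (case_nat s Var) A)))"
  using axLeib[of T t s A] by (simp add: inst_eq_psubF)

lemma eq_sym: "proves T (Imp (Eqt t s) (Eqt s t))"
  by (rule taut2[OF axRefl[of _ t] eq_replaceF[of _ t s "Eqt (Var 0) (liftT 0 t)"]]) simp

lemma eq_symD: "proves T (Eqt t s) \<Longrightarrow> proves T (Eqt s t)"
  using eq_sym mp by blast

lemma eq_trans: "proves T (Imp (Eqt t s) (Imp (Eqt s u) (Eqt t u)))"
  by (rule taut1[OF eq_replaceF[of _ s u "Eqt (liftT 0 t) (Var 0)"]]) simp

lemma eq_transD: "proves T (Eqt t s) \<Longrightarrow> proves T (Eqt s u) \<Longrightarrow> proves T (Eqt t u)"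
  using eq_trans mp by blast

text \<open>Variable 0 marks the place of replacement in \<open>c\<close>. Leibniz's law is applied
  to the equation between \<open>c\<close> with \<open>t\<close> put in, kept as a parameter, and
  \<open>c\<close> itself.\<close>

lemma eq_cong: "proves T (Imp (Eqt t s) (Eqt (psubT (case_nat t Var) c) (psubT (case_nat s Var) c)))"
  by (rule taut2[OF eq_replaceF[of _ t s "Eqt (liftT 0 (psubT (case_nat t Var) c)) c"]
        axRefl[of _ "psubT (case_nat t Var) c"]]) simp

lemma eq_Sc: "proves T (Imp (Eqt t s) (Eqt (Sc t) (Sc s)))"
  using eq_cong[of T t s "Sc (Var 0)"] by simp

lemma eq_ScD: "proves T (Eqt t s) \<Longrightarrow> proves T (Eqt (Sc t) (Sc s))"
  using eq_Sc mp by blast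

lemma eq_Ex2D: "proves T (Eqt t s) \<Longrightarrow> proves T (Eqt (Ex2 t) (Ex2 s))"
  using eq_cong[of T t s "Ex2 (Var 0)"] by (auto intro: mp)

lemma eq_Pl_right: "proves T (Imp (Eqt t s) (Eqt (Pl u t) (Pl u s)))"
  using eq_cong[of T t s "Pl (liftT 0 u) (Var 0)"] by simp

lemma eq_PlD:
  assumes "proves T (Eqt t s)" "proves T (Eqt t' s')"
  shows "proves T (Eqt (Pl t t') (Pl s s'))"
proof (rule eq_transD)
  show "proves T (Eqt (Pl t t') (Pl s t'))"
    using eq_cong[of T t s "Pl (Var 0) (liftT 0 t')"] assms by (auto intro: mp)
  show "proves T (Eqt (Pl s t') (Pl s s'))"
    using eq_Pl_right assms mp by blast
qed

lemma eq_TmD: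
  assumes "proves T (Eqt t s)" "proves T (Eqt t' s')"
  shows "proves T (Eqt (Tm t t') (Tm s s'))"
proof (rule eq_transD)
  show "proves T (Eqt (Tm t t') (Tm s t'))"
    using eq_cong[of T t s "Tm (Var 0) (liftT 0 t')"] assms by (auto intro: mp)
  show "proves T (Eqt (Tm s t') (Tm s s'))"
    using eq_cong[of T t' s' "Tm (liftT 0 s) (Var 0)"] assms by (auto intro: mp)
qed

section \<open>Quantifier rules\<close>

lemma ForallI: "proves T (Imp (liftF 0 H) A) \<Longrightarrow> proves T (Imp H (Forall A))"
  by (rule mp[OF axAllImp proves.gen])

lemma ExistsI: "proves T (Imp (psubF (case_nat t Var) A) (Exists A))"
  by (rule taut1[OF axInst[of _ "Neg A" t]]) (auto simp: holds_Exists inst_eq_psubF)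

lemma liftF_Neg [simp]: "liftF k (Neg A) = Neg (liftF k A)"
  by (simp add: Neg_def)

lemma ExistsE:
  assumes "proves T (Imp A (liftF 0 C))"
  shows "proves T (Imp (Exists A) C)"
proof -
  have "proves T (Imp (liftF 0 (Neg C)) (Neg A))"
    by (rule taut1[OF assms]) auto
  then show ?thesis
    by (rule taut1[OF ForallI]) (auto simp: holds_Exists)
qed

lemma BAllI: "proves T (Imp (liftF 0 H) (Imp (Leq (Var 0) (liftT 0 t)) A)) \<Longrightarrow> proves T (Imp H (BAll t A))"
  unfolding BAll_def by (rule ForallI)

lemma BAllE: "proves T (Imp (BAll t A) (Imp (Leq u t) (psubF (case_nat u Var) A)))"
  using axInst[of T "Imp (Leq (Var 0) (liftT 0 t)) A" u] by (simp add: inst_eq_psubF BAll_def)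

lemma BExI: "proves T (Imp (Leq u t) (Imp (psubF (case_nat u Var) A) (BEx t A)))"
  by (rule taut1[OF BAllE[of _ t "Neg A" u]]) (auto simp: holds_BEx)

lemma BExE:
  assumes "proves T (Imp A (liftF 0 C))"
  shows "proves T (Imp (BEx t A) C)"
proof -
  have "proves T (Imp (liftF 0 (Neg C)) (Imp (Leq (Var 0) (liftT 0 t)) (Neg A)))"
    by (rule taut1[OF assms]) auto
  then show ?thesis
    by (rule taut1[OF BAllI]) (auto simp: holds_BEx)
qed

section \<open>The ordering in EA\<close>

lemma EA_LeqI: "proves EA (Imp (Eqt (Pl u t) s) (Leq t s))"
  by (rule taut2[OF EA_Leq[of t s] ExistsI[of _ u "Eqt (Pl (Var 0) (liftT 0 t)) (liftT 0 s)"]]) auto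

text \<open>In the axiom for \<open>Leq\<close> the difference is the left summand. Since addition
  recurses on its right summand, a successor in \<open>t\<close> can be pulled out of the sum
  without commutativity.\<close>

lemma EA_LeqE:
  assumes "proves EA (Imp (Eqt (Pl (Var 0) (liftT 0 t)) (liftT 0 s)) (liftF 0 C))"
  shows "proves EA (Imp (Leq t s) C)"
  by (rule taut2[OF EA_Leq[of t s] ExistsE[OF assms]]) auto

lemma EA_Zr_Leq: "proves EA (Leq Zr t)"
  by (rule mp[OF EA_LeqI EA_Pl_Zr])

lemma EA_Pl_Sc_eq: "proves EA (Imp (Eqt (Pl u t) s) (Eqt (Pl u (Sc t)) (Sc s)))"
  by (rule taut3[OF EA_Pl_Sc[of u t] eq_trans[of _ "Pl u (Sc t)" "Sc (Pl u t)" "Sc s"]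
        eq_Sc[of _ "Pl u t" s]]) auto

lemma EA_Leq_Sc_Sc: "proves EA (Imp (Leq t s) (Leq (Sc t) (Sc s)))"
proof (rule EA_LeqE)
  show "proves EA (Imp (Eqt (Pl (Var 0) (liftT 0 t)) (liftT 0 s)) (liftF 0 (Leq (Sc t) (Sc s))))"
    by (rule taut2[OF EA_Pl_Sc_eq[of "Var 0" "liftT 0 t" "liftT 0 s"]
          EA_LeqI[of "Var 0" "Sc (liftT 0 t)" "Sc (liftT 0 s)"]]) auto
qed

text \<open>Supplies \<open>Leq (Var 0) (Sc (Var 0))\<close>, the bound on the predecessor in
  \<open>EA_zero_or_Sc\<close>.\<close>

lemma EA_one_Pl: "proves EA (Eqt (Pl (Sc Zr) (Var 0)) (Sc (Var 0)))"
proof (rule EA_induct)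
  show "proves EA (psubF (case_nat Zr Var) (Eqt (Pl (Sc Zr) (Var 0)) (Sc (Var 0))))"
    using EA_Pl_Zr[of "Sc Zr"] by simp
  show "proves EA (Imp (Eqt (Pl (Sc Zr) (Var 0)) (Sc (Var 0)))
     (psubF (case_nat (Sc (Var 0)) (\<lambda>i. Var (Suc i))) (Eqt (Pl (Sc Zr) (Var 0)) (Sc (Var 0)))))"
    using EA_Pl_Sc_eq[of "Sc Zr" "Var 0" "Sc (Var 0)"] by simp
qed (auto intro: Delta0.intros)

text \<open>Bounding the predecessor by the number itself keeps the formula Delta0, so induction
  applies to it.\<close>

lemma EA_zero_or_Sc: "proves EA (Disj (Eqt (Var 0) Zr) (BEx (Var 0) (Eqt (Var 1) (Sc (Var 0)))))"
proof (rule EA_induct)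
  show "proves EA (psubF (case_nat Zr Var) (Disj (Eqt (Var 0) Zr) (BEx (Var 0) (Eqt (Var 1) (Sc (Var 0))))))"
    by (rule taut1[OF axRefl[of _ Zr]]) simp
  have "proves EA (BEx (Sc (Var 0)) (Eqt (Sc (Var 1)) (Sc (Var 0))))"
    by (rule taut4[OF BExI[of _ "Var 0" "Sc (Var 0)" "Eqt (Sc (Var 1)) (Sc (Var 0))"]
        EA_LeqI[of "Sc Zr" "Var 0" "Sc (Var 0)"] EA_one_Pl axRefl[of _ "Sc (Var 0)"]]) simp
  then show "proves EA (Imp (Disj (Eqt (Var 0) Zr) (BEx (Var 0) (Eqt (Var 1) (Sc (Var 0)))))
     (psubF (case_nat (Sc (Var 0)) (\<lambda>i. Var (Suc i))) (Disj (Eqt (Var 0) Zr) (BEx (Var 0) (Eqt (Var 1) (Sc (Var 0)))))))"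
    by (rule taut1) simp
qed (auto intro: Delta0.intros)

text \<open>In the second premise variable 0 is the predecessor, and index 1 stays reserved for the
  original number, to match the body of the bounded quantifier in
  \<open>EA_zero_or_Sc\<close>.\<close>

lemma EA_cases:
  assumes "proves EA (psubF (case_nat Zr Var) C)"
    and "proves EA (psubF (case_nat (Sc (Var 0)) (\<lambda>i. Var (Suc (Suc i)))) C)"
  shows "proves EA C"
proof -
  \<comment> \<open>A copy of \<open>C\<close> with variable 0 as a hole and two fresh indices after
    it. The hole filled by \<open>Sc (Var 0)\<close> gives the successor case; filled by
    \<open>Var 1\<close> it gives the lifted \<open>C\<close>.\<close>
  let ?C = "psubF (case_nat (Var 0) (\<lambda>i. Var (Suc (Suc (Suc i))))) C"
  have "(\<lambda>i. psubT (case_nat (Sc (Var 0)) Var) (case_nat (Var 0) (\<lambda>i. Var (Suc (Suc (Suc i)))) i))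
     = case_nat (Sc (Var 0)) (\<lambda>i. Var (Suc (Suc i)))"
   "(\<lambda>i. psubT (case_nat (Var 1) Var) (case_nat (Var 0) (\<lambda>i. Var (Suc (Suc (Suc i)))) i))
     = (\<lambda>i. Var (Suc i))"
    by (auto split: nat.splits)
  then have "proves EA (Imp (Eqt (Sc (Var 0)) (Var 1))
      (Imp (psubF (case_nat (Sc (Var 0)) (\<lambda>i. Var (Suc (Suc i)))) C) (liftF 0 C)))"
    using eq_replaceF[of EA "Sc (Var 0)" "Var 1" ?C] by (simp add: liftF_0)
  then have "proves EA (Imp (Eqt (Var 1) (Sc (Var 0))) (liftF 0 C))"
    by (rule taut3[OF _ assms(2) eq_sym[of _ "Var 1" "Sc (Var 0)"]]) auto
  then have Sc: "proves EA (Imp (BEx (Var 0) (Eqt (Var 1) (Sc (Var 0)))) C)"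
    by (rule BExE)
  have "(\<lambda>i. psubT (case_nat Zr Var) (case_nat (Var 0) (\<lambda>i. Var (Suc (Suc i))) i))
     = case_nat Zr (\<lambda>i. Var (Suc i))"
   "(\<lambda>i. psubT (case_nat (Var 0) Var) (case_nat (Var 0) (\<lambda>i. Var (Suc (Suc i))) i)) = Var"
    by (auto split: nat.splits)
  then have *: "proves EA (Imp (Eqt Zr (Var 0)) (Imp (psubF (case_nat Zr (\<lambda>i. Var (Suc i))) C) C))"
    using eq_replaceF[of EA Zr "Var 0" "psubF (case_nat (Var 0) (\<lambda>i. Var (Suc (Suc i)))) C"] by simp
  have "(\<lambda>i. psubT (\<lambda>i. Var (Suc i)) (case_nat Zr Var i)) = case_nat Zr (\<lambda>i. Var (Suc i))"
    by (auto split: nat.splits)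
  then have "proves EA (psubF (case_nat Zr (\<lambda>i. Var (Suc i))) C)"
    using EA_psubF[OF assms(1), of "\<lambda>i. Var (Suc i)"] by simp
  then have Zr: "proves EA (Imp (Eqt (Var 0) Zr) C)"
    by (rule taut3[OF _ * eq_sym[of _ "Var 0" Zr]]) auto
  show ?thesis by (rule taut3[OF EA_zero_or_Sc Sc Zr]) auto
qed

text \<open>The induction on \<open>n\<close> is in the metalanguage; in its step the variable is
  split inside EA into zero and successor.\<close>

lemma EA_Leq_total: "proves EA (Disj (Leq (Var 0) (num n)) (Leq (num n) (Var 0)))"
proof (induction n)
  case 0
  show ?case by (rule taut1[OF EA_Zr_Leq[of "Var 0"]]) simp
next
  case (Suc n)
  show ?case
  proof (rule EA_cases)
    show "proves EA (psubF (case_nat Zr Var) (Disj (Leq (Var 0) (num (Suc n))) (Leq (num (Suc n)) (Var 0))))"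
      by (rule taut1[OF EA_Zr_Leq[of "num (Suc n)"]]) simp
    show "proves EA (psubF (case_nat (Sc (Var 0)) (\<lambda>i. Var (Suc (Suc i))))
        (Disj (Leq (Var 0) (num (Suc n))) (Leq (num (Suc n)) (Var 0))))"
      by (rule taut3[OF Suc EA_Leq_Sc_Sc[of "Var 0" "num n"] EA_Leq_Sc_Sc[of "num n" "Var 0"]]) auto
  qed
qed

lemma EA_Sc_Pl_num: "proves EA (Eqt (Pl (Sc t) (num n)) (Sc (Pl t (num n))))"
proof (induction n)
  case 0
  show ?case
    using eq_transD[OF EA_Pl_Zr[of "Sc t"] eq_symD[OF eq_ScD[OF EA_Pl_Zr[of t]]]] by simp
next
  case (Suc n)
  show ?case
    using eq_transD[OF EA_Pl_Sc[of "Sc t" "num n"] eq_transD[OF eq_ScD[OF Suc]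
          eq_symD[OF eq_ScD[OF EA_Pl_Sc[of t "num n"]]]]] by simp
qed

lemma EA_Leq_num_mono: "m \<le> n \<Longrightarrow> proves EA (Imp (Leq (num n) t) (Leq (num m) t))"
proof (induction n)
  case 0
  then show ?case by (intro taut0) simp
next
  case (Suc n)
  \<comment> \<open>If z is the difference witnessing the left side, \<open>Sc z\<close> witnesses
    the right side, because \<open>Sc z + n = z + Sc n\<close>.\<close>
  have "proves EA (Imp (Leq (num (Suc n)) t) (Leq (num n) t))"
  proof (rule EA_LeqE)
    have "proves EA (Eqt (Pl (Sc (Var 0)) (num n)) (Pl (Var 0) (num (Suc n))))"
      using eq_transD[OF EA_Sc_Pl_num eq_symD[OF EA_Pl_Sc]] by simp
    then have "proves EA (Imp (Eqt (Pl (Var 0) (num (Suc n))) (liftT 0 t)) (Leq (num n) (liftT 0 t)))"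
      by (rule taut3[OF _ EA_LeqI[of "Sc (Var 0)" "num n" "liftT 0 t"]
        eq_trans[of _ "Pl (Sc (Var 0)) (num n)" "Pl (Var 0) (num (Suc n))" "liftT 0 t"]]) simp
    then show "proves EA (Imp (Eqt (Pl (Var 0) (liftT 0 (num (Suc n)))) (liftT 0 t)) (liftF 0 (Leq (num n) t)))"
      by simp
  qed
  note step = this
  show ?case
  proof (cases "m = Suc n")
    case True
    then show ?thesis by (intro taut0) simp
  next
    case False
    then have "m \<le> n" using Suc.prems by simp
    then show ?thesis by (rule taut2[OF Suc.IH step]) simp
  qed
qed

fun eq_upto :: "trm \<Rightarrow> nat \<Rightarrow> fm" where
  "eq_upto t 0 = Eqt t Zr"
| "eq_upto t (Suc n) = Disj (eq_upto t n) (Eqt t (num (Suc n)))"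

lemma psubF_eq_upto [simp]: "psubF \<sigma> (eq_upto t n) = eq_upto (psubT \<sigma> t) n"
  by (induction n) auto

lemma eq_upto_elim:
  assumes "\<And>m. m \<le> n \<Longrightarrow> proves T (Imp (Eqt t (num m)) C)"
  shows "proves T (Imp (eq_upto t n) C)"
  using assms
proof (induction n)
  case 0
  from 0[of 0] show ?case by simp
next
  case (Suc n)
  have "proves T (Imp (eq_upto t n) C)" by (rule Suc.IH) (use Suc.prems in auto)
  then show ?case by (rule taut2[OF _ Suc.prems[of "Suc n"]]) auto
qed

lemma eq_upto_intro: "m \<le> n \<Longrightarrow> proves T (Imp (Eqt t (num m)) (eq_upto t n))"
proof (induction n)
  case 0
  then show ?case by (intro taut0) simp
next
  case (Suc n)
  show ?case
  proof (cases "m = Suc n")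
    case True
    then show ?thesis by (intro taut0) simp
  next
    case False
    then have "m \<le> n" using Suc.prems by simp
    then show ?thesis by (rule taut1[OF Suc.IH]) auto
  qed
qed

text \<open>Below a numeral EA sees only numerals; this reduces a bounded quantifier to finitely
  many instances. In the induction on \<open>n\<close>, a successor that is at most
  \<open>Suc n\<close> has its predecessor at most \<open>n\<close>.\<close>

lemma EA_Leq_num_Var: "proves EA (Imp (Leq (Var 0) (num n)) (eq_upto (Var 0) n))"
proof (induction n)
  case 0
  show ?case
  proof (rule EA_cases)
    show "proves EA (psubF (case_nat Zr Var) (Imp (Leq (Var 0) (num 0)) (eq_upto (Var 0) 0)))"
      by (rule taut1[OF axRefl[of _ Zr]]) simp
    have "proves EA (Imp (Leq (Sc (Var 0)) Zr) Fls)"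
    proof (rule EA_LeqE)
      show "proves EA (Imp (Eqt (Pl (Var 0) (liftT 0 (Sc (Var 0)))) (liftT 0 Zr)) (liftF 0 Fls))"
        by (rule taut4[OF EA_Sc_neq_Zr[of "Pl (Var 0) (Var 1)"] EA_Pl_Sc[of "Var 0" "Var 1"]
              eq_trans[of _ "Sc (Pl (Var 0) (Var 1))" "Pl (Var 0) (Sc (Var 1))" Zr]
              eq_sym[of _ "Pl (Var 0) (Sc (Var 1))" "Sc (Pl (Var 0) (Var 1))"]]) simp
    qed
    then show "proves EA (psubF (case_nat (Sc (Var 0)) (\<lambda>i. Var (Suc (Suc i))))
        (Imp (Leq (Var 0) (num 0)) (eq_upto (Var 0) 0)))"
      by (rule taut1) simp
  qed
next
  case (Suc n)
  show ?case
  proof (rule EA_cases)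
    show "proves EA (psubF (case_nat Zr Var) (Imp (Leq (Var 0) (num (Suc n))) (eq_upto (Var 0) (Suc n))))"
      using taut2[OF eq_upto_intro[of 0 "Suc n" _ Zr] axRefl[of _ Zr]] by simp
    have 1: "proves EA (Imp (eq_upto (Var 0) n) (eq_upto (Sc (Var 0)) (Suc n)))"
    proof (rule eq_upto_elim)
      fix m assume "m \<le> n"
      then have "Suc m \<le> Suc n" by simp
      from taut2[OF eq_Sc[of _ "Var 0" "num m"] eq_upto_intro[OF this, of _ "Sc (Var 0)"]]
      show "proves EA (Imp (Eqt (Var 0) (num m)) (eq_upto (Sc (Var 0)) (Suc n)))" by simp
    qed
    have 2: "proves EA (Imp (Leq (Sc (Var 0)) (Sc (num n))) (Leq (Var 0) (num n)))"
    proof (rule EA_LeqE)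
      have "proves EA (Imp (Eqt (Pl (Var 0) (Sc (Var 1))) (Sc (num n))) (Eqt (Sc (Pl (Var 0) (Var 1))) (Sc (num n))))"
        by (rule taut3[OF EA_Pl_Sc[of "Var 0" "Var 1"]
              eq_trans[of _ "Sc (Pl (Var 0) (Var 1))" "Pl (Var 0) (Sc (Var 1))" "Sc (num n)"]
              eq_sym[of _ "Pl (Var 0) (Sc (Var 1))" "Sc (Pl (Var 0) (Var 1))"]]) simp
      then show "proves EA (Imp (Eqt (Pl (Var 0) (liftT 0 (Sc (Var 0)))) (liftT 0 (Sc (num n)))) (liftF 0 (Leq (Var 0) (num n))))"
        by (rule taut3[OF _ EA_Sc_inj[of "Pl (Var 0) (Var 1)" "num n"] EA_LeqI[of "Var 0" "Var 1" "num n"]]) simp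
    qed
    show "proves EA (psubF (case_nat (Sc (Var 0)) (\<lambda>i. Var (Suc (Suc i))))
        (Imp (Leq (Var 0) (num (Suc n))) (eq_upto (Var 0) (Suc n))))"
      using taut3[OF Suc 1 2] by simp
  qed
qed

lemma EA_Leq_num: "proves EA (Imp (Leq t (num n)) (eq_upto t n))"
  using EA_psubF[OF EA_Leq_num_Var[of n], of "\<lambda>_. t"] by simp

section \<open>Computation with numerals and Delta0 completeness of EA\<close>

lemma EA_num_Pl: "proves EA (Eqt (Pl (num m) (num n)) (num (m + n)))"
proof (induction n)
  case (Suc n)
  show ?case using eq_transD[OF EA_Pl_Sc eq_ScD[OF Suc]] by simp
qed (simp add: EA_Pl_Zr)

lemma EA_num_Tm: "proves EA (Eqt (Tm (num m) (num n)) (num (m * n)))"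
proof (induction n)
  case (Suc n)
  show ?case
    using eq_transD[OF EA_Tm_Sc eq_transD[OF eq_PlD[OF Suc axRefl] EA_num_Pl]] by (simp add: add.commute)
qed (simp add: EA_Tm_Zr)

lemma EA_num_Ex2: "proves EA (Eqt (Ex2 (num n)) (num (2 ^ n)))"
proof (induction n)
  case (Suc n)
  show ?case using eq_transD[OF EA_Ex2_Sc eq_transD[OF eq_PlD[OF Suc Suc] EA_num_Pl]] by (simp add: mult_2)
qed (simp add: EA_Ex2_Zr)

lemma EA_eval_term: "proves EA (Eqt (psubT (\<lambda>i. num (e i)) t) (num (evalT e t)))"
proof (induction t)
  case (Pl t s)
  then show ?case using eq_transD[OF eq_PlD EA_num_Pl] by simp
next
  case (Tm t s)
  then show ?case using eq_transD[OF eq_TmD EA_num_Tm] by simp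
next
  case (Ex2 t)
  then show ?case using eq_transD[OF eq_Ex2D EA_num_Ex2] by simp
qed (simp_all add: axRefl eq_ScD)

lemma EA_num_neq: "m \<noteq> n \<Longrightarrow> proves EA (Neg (Eqt (num m) (num n)))"
proof (induction m n rule: diff_induct)
  case (1 m)
  then obtain k where "m = Suc k" by (cases m) auto
  then show ?case using EA_Sc_neq_Zr[of "num k"] by simp
next
  case (2 n)
  show ?case using taut2[OF EA_Sc_neq_Zr[of "num n"] eq_sym[of _ Zr "Sc (num n)"]] by simp
next
  case (3 m n)
  then have "proves EA (Neg (Eqt (num m) (num n)))" by simp
  then show ?case by (rule taut2[OF _ EA_Sc_inj[of "num m" "num n"]]) simp
qed

lemma EA_num_Leq: "m \<le> n \<Longrightarrow> proves EA (Leq (num m) (num n))"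
  using mp[OF EA_LeqI EA_num_Pl[of "n - m" m]] by simp

lemma EA_num_not_Leq:
  assumes "\<not> m \<le> n"
  shows "proves EA (Neg (Leq (num m) (num n)))"
proof -
  have "proves EA (Imp (eq_upto (num m) n) Fls)"
  proof (rule eq_upto_elim)
    fix k assume "k \<le> n"
    then have "m \<noteq> k" using assms by simp
    then show "proves EA (Imp (Eqt (num m) (num k)) Fls)" using EA_num_neq by (simp add: Neg_def)
  qed
  then show ?thesis by (rule taut2[OF _ EA_Leq_num[of "num m" n]]) simp
qed

lemma Leq_replace: "proves T (Eqt t t') \<Longrightarrow> proves T (Eqt s s') \<Longrightarrow> proves T (Iff (Leq t s) (Leq t' s'))"
proof -
  have *: "proves T (Imp (Leq t s) (Leq t' s'))" if e: "proves T (Eqt t t')" "proves T (Eqt s s')" for t s t' s'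
    using taut4[OF e eq_replaceF[of T t t' "Leq (Var 0) (liftT 0 s)"]
        eq_replaceF[of T s s' "Leq (liftT 0 t') (Var 0)"], of "Imp (Leq t s) (Leq t' s')"] by simp
  assume e: "proves T (Eqt t t')" "proves T (Eqt s s')"
  show ?thesis by (rule taut2[OF *[OF e] *[OF e[THEN eq_symD]]]) auto
qed

text \<open>Induction on the formula for all numeral assignments at once. A true bounded quantifier
  is proved by splitting its variable into the numerals up to the value of the bound; a false one is
  refuted at a counterexample.\<close>

theorem EA_Delta0_decides:
  assumes "Delta0 A"
  shows "if evalF e A then proves EA (psubF (\<lambda>i. num (e i)) A) else proves EA (Neg (psubF (\<lambda>i. num (e i)) A))"
  using assms
proof (induction A arbitrary: e rule: Delta0.induct)
  case 1
  show ?case by (simp, rule taut0) simp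
next
  case (2 t s)
  let ?t = "psubT (\<lambda>i. num (e i)) t" and ?s = "psubT (\<lambda>i. num (e i)) s"
  show ?case
  proof (cases "evalT e t = evalT e s")
    case True
    then show ?thesis using eq_transD[OF EA_eval_term[of e t] eq_symD] EA_eval_term[of e s] by simp
  next
    case False
    have "proves EA (Imp (Eqt ?t ?s) (Eqt (num (evalT e t)) (num (evalT e s))))"
      by (rule taut4[OF eq_symD[OF EA_eval_term[of e t]] EA_eval_term[of e s]
            eq_trans[of _ "num (evalT e t)" ?t ?s] eq_trans[of _ "num (evalT e t)" ?s "num (evalT e s)"]]) simp
    then have "proves EA (Neg (Eqt ?t ?s))"
      by (rule taut2[OF _ EA_num_neq[OF False]]) simp
    then show ?thesis using False by simp
  qed
next
  case (3 t s)
  show ?case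
    using taut2[OF Leq_replace[OF EA_eval_term[of e t] EA_eval_term[of e s]]
        EA_num_Leq[of "evalT e t" "evalT e s"], of "psubF (\<lambda>i. num (e i)) (Leq t s)"]
      taut2[OF Leq_replace[OF EA_eval_term[of e t] EA_eval_term[of e s]]
        EA_num_not_Leq[of "evalT e t" "evalT e s"], of "Neg (psubF (\<lambda>i. num (e i)) (Leq t s))"]
    by auto
next
  case (4 A B)
  let ?A = "psubF (\<lambda>i. num (e i)) A" and ?B = "psubF (\<lambda>i. num (e i)) B"
  consider "\<not> evalF e A" | "evalF e B" | "evalF e A" "\<not> evalF e B" by blast
  then show ?case
  proof cases
    case 1
    then have "proves EA (Imp ?A ?B)" using taut1[of EA "Neg ?A" "Imp ?A ?B"] 4(3)[of e] by simp
    then show ?thesis using 1 by simp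
  next
    case 2
    then have "proves EA (Imp ?A ?B)" using taut1[of EA ?B "Imp ?A ?B"] 4(4)[of e] by simp
    then show ?thesis using 2 by simp
  next
    case 3
    then have "proves EA (Neg (Imp ?A ?B))"
      using taut2[of EA ?A "Neg ?B" "Neg (Imp ?A ?B)"] 4(3)[of e] 4(4)[of e] by simp
    then show ?thesis using 3 by simp
  qed
next
  case (5 A t)
  let ?\<sigma> = "\<lambda>i. num (e i)" and ?n = "evalT e t"
  have \<sigma>: "(\<lambda>i. psubT (case_nat (num m) Var) (up ?\<sigma> i)) = (\<lambda>i. num (case_nat m e i))" for m
    by (auto simp: up_def split: nat.splits)
  have F: "psubF ?\<sigma> (Forall (Imp (Leq (Var 0) (liftT 0 t)) A)) = BAll (psubT ?\<sigma> t) (psubF (up ?\<sigma>) A)"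
    by (simp add: BAll_def)
  show ?case
  proof (cases "\<forall>m \<le> ?n. evalF (case_nat m e) A")
    case True
    have "proves EA (Imp (eq_upto (Var 0) ?n) (psubF (up ?\<sigma>) A))"
    proof (rule eq_upto_elim)
      fix m assume "m \<le> ?n"
      then have A: "proves EA (psubF (\<lambda>i. num (case_nat m e i)) A)" using True 5(2)[of "case_nat m e"] by simp
      \<comment> \<open>The Leibniz formula has variable 0 as its hole and numerals elsewhere:
        filled by \<open>num m\<close> it is the instance already proved, filled by
        \<open>Var 0\<close> it is the body of the quantifier.\<close>
      have *: "(\<lambda>i. psubT (case_nat (num m) Var) (case_nat (Var 0) (\<lambda>i. num (e i)) i)) = (\<lambda>i. num (case_nat m e i))"
         "(\<lambda>i. psubT (case_nat (Var 0) Var) (case_nat (Var 0) (\<lambda>i. num (e i)) i)) = up ?\<sigma>"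
        by (auto simp: up_def split: nat.splits)
      have "proves EA (Imp (Eqt (num m) (Var 0)) (Imp (psubF (\<lambda>i. num (case_nat m e i)) A) (psubF (up ?\<sigma>) A)))"
        using eq_replaceF[of EA "num m" "Var 0" "psubF (case_nat (Var 0) (\<lambda>i. num (e i))) A"]
        unfolding psubF_psubF * by simp
      then show "proves EA (Imp (Eqt (Var 0) (num m)) (psubF (up ?\<sigma>) A))"
        by (rule taut3[OF _ A eq_sym[of _ "Var 0" "num m"]]) simp
    qed
    then have "proves EA (Imp (Leq (Var 0) (num ?n)) (psubF (up ?\<sigma>) A))"
      by (rule taut2[OF _ EA_Leq_num[of "Var 0" ?n]]) simp
    moreover have "proves EA (Iff (Leq (Var 0) (liftT 0 (psubT ?\<sigma> t))) (Leq (Var 0) (num ?n)))"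
    proof (rule Leq_replace[OF axRefl])
      show "proves EA (Eqt (liftT 0 (psubT ?\<sigma> t)) (num ?n))"
        using EA_eval_term[of e t] by (simp add: liftT_0)
    qed
    ultimately have "proves EA (Imp (Leq (Var 0) (liftT 0 (psubT ?\<sigma> t))) (psubF (up ?\<sigma>) A))"
      by (rule taut2) simp
    then have "proves EA (BAll (psubT ?\<sigma> t) (psubF (up ?\<sigma>) A))"
      unfolding BAll_def by (rule proves.gen)
    then show ?thesis using True F by simp
  next
    case False
    then obtain m where m: "m \<le> ?n" "\<not> evalF (case_nat m e) A" by blast
    have "proves EA (Neg (psubF (\<lambda>i. num (case_nat m e i)) A))" using m 5(2)[of "case_nat m e"] by simp
    moreover have "proves EA (Leq (num m) (psubT ?\<sigma> t))"
      by (rule taut2[OF EA_num_Leq[OF m(1)] Leq_replace[OF axRefl[of _ "num m"] EA_eval_term[of e t]]]) simp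
    moreover have "proves EA (Imp (BAll (psubT ?\<sigma> t) (psubF (up ?\<sigma>) A))
        (Imp (Leq (num m) (psubT ?\<sigma> t)) (psubF (\<lambda>i. num (case_nat m e i)) A)))"
      using BAllE[of EA "psubT ?\<sigma> t" "psubF (up ?\<sigma>) A" "num m"] unfolding psubF_psubF \<sigma> .
    ultimately have "proves EA (Neg (BAll (psubT ?\<sigma> t) (psubF (up ?\<sigma>) A)))"
      by (rule taut3) simp
    then show ?thesis using False F by auto
  qed
qed

section \<open>Sigma-1 definability in the standard model\<close>

text \<open>Definability is stated for functions and relations of the environment, so that formulas
  about coded syntax arise from closure lemmas and need not be written out.\<close>

definition term_fun :: "((nat \<Rightarrow> nat) \<Rightarrow> nat) \<Rightarrow> bool" where
  "term_fun f \<longleftrightarrow> (\<exists>t. \<forall>e. evalT e t = f e)"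

definition delta0_pred :: "((nat \<Rightarrow> nat) \<Rightarrow> bool) \<Rightarrow> bool" where
  "delta0_pred P \<longleftrightarrow> (\<exists>A. Delta0 A \<and> (\<forall>e. evalF e A = P e))"

definition sigma1_pred :: "((nat \<Rightarrow> nat) \<Rightarrow> bool) \<Rightarrow> bool" where
  "sigma1_pred P \<longleftrightarrow> (\<exists>Q. delta0_pred Q \<and> (\<forall>e. P e \<longleftrightarrow> (\<exists>w. Q (case_nat w e))))"

definition sigma1_fun :: "((nat \<Rightarrow> nat) \<Rightarrow> nat) \<Rightarrow> bool" where
  "sigma1_fun f \<longleftrightarrow> sigma1_pred (\<lambda>e. e 0 = f (\<lambda>i. e (Suc i)))"

lemma term_fun_Var: "term_fun (\<lambda>e. e i)"
  unfolding term_fun_def by (rule exI[of _ "Var i"]) simp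

lemma term_fun_const: "term_fun (\<lambda>e. n)"
  unfolding term_fun_def by (rule exI[of _ "num n"]) simp

lemma term_fun_Suc: "term_fun f \<Longrightarrow> term_fun (\<lambda>e. Suc (f e))"
  unfolding term_fun_def by (metis evalT.simps(3))

lemma term_fun_add: "term_fun f \<Longrightarrow> term_fun g \<Longrightarrow> term_fun (\<lambda>e. f e + g e)"
  unfolding term_fun_def by (metis evalT.simps(4))

lemma term_fun_mult: "term_fun f \<Longrightarrow> term_fun g \<Longrightarrow> term_fun (\<lambda>e. f e * g e)"
  unfolding term_fun_def by (metis evalT.simps(5))

lemma term_fun_exp: "term_fun f \<Longrightarrow> term_fun (\<lambda>e. 2 ^ f e)"
  unfolding term_fun_def by (metis evalT.simps(6))

lemmas term_fun_intros = term_fun_Var term_fun_const term_fun_Suc term_fun_add term_fun_mult term_fun_exp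

lemma term_fun_env:
  assumes "\<And>i. term_fun (\<lambda>e. s e i)"
  obtains \<sigma> where "\<And>e. (\<lambda>i. evalT e (\<sigma> i)) = s e"
proof -
  have "\<forall>i. \<exists>t. \<forall>e. evalT e t = s e i" using assms unfolding term_fun_def by blast
  then obtain \<sigma> where "\<forall>i e. evalT e (\<sigma> i) = s e i" by metis
  then show ?thesis using that[of \<sigma>] by auto
qed

lemma term_fun_subst: "term_fun f \<Longrightarrow> (\<And>i. term_fun (\<lambda>e. s e i)) \<Longrightarrow> term_fun (\<lambda>e. f (s e))"
  using term_fun_env[of s] unfolding term_fun_def by (metis evalT_psubT)

lemma term_fun_shift: "term_fun f \<Longrightarrow> term_fun (\<lambda>e. f (\<lambda>i. e (Suc i)))"
  by (rule term_fun_subst) (auto intro: term_fun_intros)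

lemma term_fun_case_nat:
  "term_fun f \<Longrightarrow> (\<And>i. term_fun (\<lambda>e. s e i)) \<Longrightarrow> term_fun (\<lambda>e. case_nat (f e) (s e) i)"
  by (cases i) auto

lemma delta0_subst: "delta0_pred P \<Longrightarrow> (\<And>i. term_fun (\<lambda>e. s e i)) \<Longrightarrow> delta0_pred (\<lambda>e. P (s e))"
  using term_fun_env[of s] unfolding delta0_pred_def by (metis evalF_psubF Delta0_psubF)

lemma delta0_eq: "term_fun f \<Longrightarrow> term_fun g \<Longrightarrow> delta0_pred (\<lambda>e. f e = g e)"
  unfolding delta0_pred_def term_fun_def by (metis evalF.simps(2) Delta0.intros(2))

lemma delta0_le: "term_fun f \<Longrightarrow> term_fun g \<Longrightarrow> delta0_pred (\<lambda>e. f e \<le> g e)"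
  unfolding delta0_pred_def term_fun_def by (metis evalF.simps(3) Delta0.intros(3))

lemma delta0_not: "delta0_pred P \<Longrightarrow> delta0_pred (\<lambda>e. \<not> P e)"
  unfolding delta0_pred_def by (metis evalF_Neg Delta0_Neg)

lemma delta0_conj: "delta0_pred P \<Longrightarrow> delta0_pred Q \<Longrightarrow> delta0_pred (\<lambda>e. P e \<and> Q e)"
  unfolding delta0_pred_def by (metis evalF_Conj Delta0_Conj)

lemma delta0_disj: "delta0_pred P \<Longrightarrow> delta0_pred Q \<Longrightarrow> delta0_pred (\<lambda>e. P e \<or> Q e)"
  unfolding delta0_pred_def by (metis evalF_Disj Delta0_Disj)

lemma delta0_less: "term_fun f \<Longrightarrow> term_fun g \<Longrightarrow> delta0_pred (\<lambda>e. f e < g e)"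
  using delta0_le[of "\<lambda>e. Suc (f e)" g] term_fun_Suc[of f] by (simp add: Suc_le_eq)

lemma delta0_ball:
  assumes "delta0_pred (\<lambda>e. P (e 0) (\<lambda>i. e (Suc i)))" and "term_fun f"
  shows "delta0_pred (\<lambda>e. \<forall>x \<le> f e. P x e)"
proof -
  obtain A t where "Delta0 A" "\<And>e. evalF e A = P (e 0) (\<lambda>i. e (Suc i))" "\<And>e. evalT e t = f e"
    using assms unfolding delta0_pred_def term_fun_def by blast
  then show ?thesis unfolding delta0_pred_def by (intro exI[of _ "BAll t A"]) auto
qed

lemma delta0_bex:
  assumes "delta0_pred (\<lambda>e. P (e 0) (\<lambda>i. e (Suc i)))" and "term_fun f"
  shows "delta0_pred (\<lambda>e. \<exists>x \<le> f e. P x e)"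
proof -
  obtain A t where "Delta0 A" "\<And>e. evalF e A = P (e 0) (\<lambda>i. e (Suc i))" "\<And>e. evalT e t = f e"
    using assms unfolding delta0_pred_def term_fun_def by blast
  then show ?thesis unfolding delta0_pred_def by (intro exI[of _ "BEx t A"]) auto
qed

lemma sigma1_subst:
  assumes "sigma1_pred P" and s: "\<And>i. term_fun (\<lambda>e. s e i)"
  shows "sigma1_pred (\<lambda>e. P (s e))"
proof -
  obtain Q where Q: "delta0_pred Q" "\<And>e. P e \<longleftrightarrow> (\<exists>w. Q (case_nat w e))"
    using assms(1) unfolding sigma1_pred_def by blast
  have "delta0_pred (\<lambda>e. Q (case_nat (e 0) (s (\<lambda>i. e (Suc i)))))"
    by (rule delta0_subst[OF Q(1)]) (intro term_fun_case_nat term_fun_Var term_fun_shift s)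
  then show ?thesis unfolding sigma1_pred_def using Q(2)
    by (intro exI[of _ "\<lambda>e. Q (case_nat (e 0) (s (\<lambda>i. e (Suc i))))"]) simp
qed

lemma delta0_sigma1:
  assumes "delta0_pred P"
  shows "sigma1_pred P"
proof -
  have "delta0_pred (\<lambda>e. P (\<lambda>i. e (Suc i)))"
    by (rule delta0_subst[OF assms]) (intro term_fun_intros)
  then show ?thesis unfolding sigma1_pred_def by (intro exI[of _ "\<lambda>e. P (\<lambda>i. e (Suc i))"]) simp
qed

lemma sigma1_disj: 
  assumes "sigma1_pred P" and "sigma1_pred Q"
  shows "sigma1_pred (\<lambda>e. P e \<or> Q e)"
proof -
  obtain P' Q' where "delta0_pred P'" "\<And>e. P e \<longleftrightarrow> (\<exists>w. P' (case_nat w e))"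
    "delta0_pred Q'" "\<And>e. Q e \<longleftrightarrow> (\<exists>w. Q' (case_nat w e))"
    using assms unfolding sigma1_pred_def by blast
  then show ?thesis unfolding sigma1_pred_def
    by (intro exI[of _ "\<lambda>e. P' e \<or> Q' e"]) (auto intro: delta0_disj)
qed

text \<open>The new witness is a bound below which both old witnesses are sought;
  \<open>sigma1_ex\<close> merges two existential quantifiers in the same way.\<close>

lemma sigma1_conj: 
  assumes "sigma1_pred P" and "sigma1_pred Q"
  shows "sigma1_pred (\<lambda>e. P e \<and> Q e)"
proof -
  obtain P' Q' where P: "delta0_pred P'" "\<And>e. P e \<longleftrightarrow> (\<exists>w. P' (case_nat w e))"
    and Q: "delta0_pred Q'" "\<And>e. Q e \<longleftrightarrow> (\<exists>w. Q' (case_nat w e))"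
    using assms unfolding sigma1_pred_def by blast
  let ?R = "\<lambda>e. (\<exists>w \<le> e 0. P' (case_nat w (\<lambda>i. e (Suc i)))) \<and> (\<exists>w \<le> e 0. Q' (case_nat w (\<lambda>i. e (Suc i))))"
  have "delta0_pred ?R"
    by (intro delta0_conj delta0_bex delta0_subst[OF P(1)] delta0_subst[OF Q(1)] term_fun_case_nat term_fun_Var)
  moreover have "P e \<and> Q e \<longleftrightarrow> (\<exists>w. ?R (case_nat w e))" for e
    unfolding P(2) Q(2) by simp (meson nat_le_linear)
  ultimately show ?thesis unfolding sigma1_pred_def by blast
qed

lemma sigma1_ex: 
  assumes "sigma1_pred (\<lambda>e. P (e 0) (\<lambda>i. e (Suc i)))"
  shows "sigma1_pred (\<lambda>e. \<exists>x. P x e)"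
proof -
  obtain Q where Q: "delta0_pred Q" "\<And>e. P (e 0) (\<lambda>i. e (Suc i)) \<longleftrightarrow> (\<exists>w. Q (case_nat w e))"
    using assms unfolding sigma1_pred_def by blast
  let ?R = "\<lambda>e. \<exists>x \<le> e 0. \<exists>w \<le> e 0. Q (case_nat w (case_nat x (\<lambda>i. e (Suc i))))"
  have "delta0_pred ?R"
    by (intro delta0_bex delta0_subst[OF Q(1)] term_fun_case_nat term_fun_Var)
  moreover have "(\<exists>x. P x e) \<longleftrightarrow> (\<exists>w. ?R (case_nat w e))" for e
    using Q(2)[of "case_nat _ e"] by simp (meson nat_le_linear)
  ultimately show ?thesis unfolding sigma1_pred_def by blast
qed

text \<open>Collection in the standard model: the bound is the maximum of finitely many chosen
  witnesses.\<close>

lemma bounded_witness: "\<forall>x \<le> n. \<exists>w. Q x w \<Longrightarrow> \<exists>b::nat. \<forall>x \<le> (n::nat). \<exists>w \<le> b. Q x w"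
proof -
  assume "\<forall>x \<le> n. \<exists>w. Q x w"
  then obtain h where h: "\<And>x. x \<le> n \<Longrightarrow> Q x (h x)" by metis
  have "\<exists>w \<le> Max (h ` {..n}). Q x w" if "x \<le> n" for x
    using h[OF that] that by (auto intro!: exI[of _ "h x"] Max_ge)
  then show ?thesis by blast
qed

lemma sigma1_ball_term:
  assumes "sigma1_pred (\<lambda>e. P (e 0) (\<lambda>i. e (Suc i)))" and "term_fun f"
  shows "sigma1_pred (\<lambda>e. \<forall>x \<le> f e. P x e)"
proof -
  obtain Q where Q: "delta0_pred Q" "\<And>e. P (e 0) (\<lambda>i. e (Suc i)) \<longleftrightarrow> (\<exists>w. Q (case_nat w e))"
    using assms unfolding sigma1_pred_def by blast
  let ?R = "\<lambda>e. \<forall>x \<le> f (\<lambda>i. e (Suc i)). \<exists>w \<le> e 0. Q (case_nat w (case_nat x (\<lambda>i. e (Suc i))))"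
  have "delta0_pred ?R"
    by (intro delta0_bex delta0_ball delta0_subst[OF Q(1)] term_fun_case_nat term_fun_Var term_fun_shift assms(2))
  moreover have "(\<forall>x \<le> f e. P x e) \<longleftrightarrow> (\<exists>w. ?R (case_nat w e))" for e
    using Q(2)[of "case_nat _ e"] bounded_witness[of "f e" "\<lambda>x w. Q (case_nat w (case_nat x e))"] by auto
  ultimately show ?thesis unfolding sigma1_pred_def by blast
qed

lemma term_sigma1_fun: "term_fun f \<Longrightarrow> sigma1_fun f"
  unfolding sigma1_fun_def by (intro delta0_sigma1 delta0_eq term_fun_Var term_fun_shift)

lemma sigma1_fun_Var: "sigma1_fun (\<lambda>e. e i)" and sigma1_fun_const: "sigma1_fun (\<lambda>e. n)"
  by (intro term_sigma1_fun term_fun_intros)+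

lemma sigma1_fun_shift: "sigma1_fun f \<Longrightarrow> sigma1_fun (\<lambda>e. f (\<lambda>i. e (Suc i)))"
  unfolding sigma1_fun_def
  using sigma1_subst[of "\<lambda>e. e 0 = f (\<lambda>i. e (Suc i))" "\<lambda>e. case_nat (e 0) (\<lambda>i. e (Suc (Suc i)))"]
    term_fun_case_nat[of "\<lambda>e. e 0" "\<lambda>e i. e (Suc (Suc i))"] by (simp add: term_fun_Var)

lemma sigma1_fun_subst:
  assumes "sigma1_pred (\<lambda>e. P (e 0) (\<lambda>i. e (Suc i)))" and "sigma1_fun f"
  shows "sigma1_pred (\<lambda>e. P (f e) e)"
proof -
  have "sigma1_pred (\<lambda>e. \<exists>y. y = f e \<and> P y e)"
    by (intro sigma1_ex sigma1_conj assms(1) assms(2)[unfolded sigma1_fun_def])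
  then show ?thesis by simp
qed

section \<open>Computably enumerable relations and composition with functions of Sigma1
  graph\<close>

definition ce1 :: "(nat \<Rightarrow> bool) \<Rightarrow> bool" where
  "ce1 R \<longleftrightarrow> sigma1_pred (\<lambda>e. R (e 0))"

definition ce2 :: "(nat \<Rightarrow> nat \<Rightarrow> bool) \<Rightarrow> bool" where
  "ce2 R \<longleftrightarrow> sigma1_pred (\<lambda>e. R (e 0) (e 1))"

definition ce3 :: "(nat \<Rightarrow> nat \<Rightarrow> nat \<Rightarrow> bool) \<Rightarrow> bool" where
  "ce3 R \<longleftrightarrow> sigma1_pred (\<lambda>e. R (e 0) (e 1) (e 2))"

lemma ce1_app: "ce1 R \<Longrightarrow> sigma1_fun f \<Longrightarrow> sigma1_pred (\<lambda>e. R (f e))"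
  unfolding ce1_def by (rule sigma1_fun_subst)

lemma ce2_app:
  assumes "ce2 R" "sigma1_fun f" "sigma1_fun g"
  shows "sigma1_pred (\<lambda>e. R (f e) (g e))"
proof (rule sigma1_fun_subst[OF _ assms(2)], rule sigma1_fun_subst[OF _ sigma1_fun_shift[OF assms(3)]])
  show "sigma1_pred (\<lambda>e. R (e (Suc 0)) (e 0))"
    using sigma1_subst[OF assms(1)[unfolded ce2_def], of "\<lambda>e. case_nat (e 1) (\<lambda>_. e 0)"]
      term_fun_case_nat[of "\<lambda>e. e 1" "\<lambda>e i. e 0"] by (simp add: term_fun_Var)
qed

lemma ce3_app:
  assumes "ce3 R" "sigma1_fun f" "sigma1_fun g" "sigma1_fun h"
  shows "sigma1_pred (\<lambda>e. R (f e) (g e) (h e))"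
proof (rule sigma1_fun_subst[OF _ assms(2)], rule sigma1_fun_subst[OF _ sigma1_fun_shift[OF assms(3)]],
    rule sigma1_fun_subst[OF _ sigma1_fun_shift[OF sigma1_fun_shift[OF assms(4)]]])
  show "sigma1_pred (\<lambda>e. R (e (Suc (Suc 0))) (e (Suc 0)) (e 0))"
    using sigma1_subst[OF assms(1)[unfolded ce3_def], of "\<lambda>e. case_nat (e 2) (case_nat (e 1) (\<lambda>_. e 0))"]
      term_fun_case_nat[of "\<lambda>e. e 2" "\<lambda>e. case_nat (e 1) (\<lambda>_. e 0)"]
      term_fun_case_nat[of "\<lambda>e. e 1" "\<lambda>e i. e 0"] by (simp add: term_fun_Var numeral_2_eq_2)
qed

lemma sigma1_fun_comp1: "ce2 (\<lambda>y x. y = h x) \<Longrightarrow> sigma1_fun f \<Longrightarrow> sigma1_fun (\<lambda>e. h (f e))"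
  using ce2_app[of "\<lambda>y x. y = h x" "\<lambda>e. e 0" "\<lambda>e. f (\<lambda>i. e (Suc i))"]
  by (simp add: sigma1_fun_def[of "\<lambda>e. h (f e)"] sigma1_fun_Var sigma1_fun_shift)

lemma sigma1_fun_comp2:
  "ce3 (\<lambda>z x y. z = h x y) \<Longrightarrow> sigma1_fun f \<Longrightarrow> sigma1_fun g \<Longrightarrow> sigma1_fun (\<lambda>e. h (f e) (g e))"
  using ce3_app[of "\<lambda>z x y. z = h x y" "\<lambda>e. e 0" "\<lambda>e. f (\<lambda>i. e (Suc i))" "\<lambda>e. g (\<lambda>i. e (Suc i))"]
  by (simp add: sigma1_fun_def[of "\<lambda>e. h (f e) (g e)"] sigma1_fun_Var sigma1_fun_shift)

lemma sigma1_fun_Suc: "sigma1_fun f \<Longrightarrow> sigma1_fun (\<lambda>e. Suc (f e))"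
  by (rule sigma1_fun_comp1) (simp_all add: ce2_def delta0_sigma1 delta0_eq term_fun_intros)

text \<open>Doubling removes the division from the triangular number, so the graph of pairing
  becomes an equation between terms.\<close>

lemma ce3_prod_encode: "ce3 (\<lambda>z x y. z = prod_encode (x, y))"
proof -
  have "z = prod_encode (x, y) \<longleftrightarrow> 2 * z = (x + y) * Suc (x + y) + 2 * x" for x y z
  proof -
    have "2 * triangle n = n * Suc n" for n unfolding triangle_def by simp
    then have "2 * prod_encode (x, y) = (x + y) * Suc (x + y) + 2 * x"
      unfolding prod_encode_def prod.case by (simp only: distrib_left)
    then show ?thesis by auto
  qed
  then show ?thesis unfolding ce3_def
    by (simp only:) (intro delta0_sigma1 delta0_eq term_fun_intros)
qed

lemmas sigma1_fun_prod_encode = sigma1_fun_comp2[OF ce3_prod_encode]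

lemma sigma1_eq: "sigma1_fun f \<Longrightarrow> sigma1_fun g \<Longrightarrow> sigma1_pred (\<lambda>e. f e = g e)"
  by (rule ce2_app[of "(=)"]) (auto simp: ce2_def intro!: delta0_sigma1 delta0_eq term_fun_intros)

lemma sigma1_less: "sigma1_fun f \<Longrightarrow> sigma1_fun g \<Longrightarrow> sigma1_pred (\<lambda>e. f e < g e)"
  by (rule ce2_app[of "(<)"]) (auto simp: ce2_def intro!: delta0_sigma1 delta0_less term_fun_intros)

lemma sigma1_le: "sigma1_fun f \<Longrightarrow> sigma1_fun g \<Longrightarrow> sigma1_pred (\<lambda>e. f e \<le> g e)"
  by (rule ce2_app[of "(\<le>)"]) (auto simp: ce2_def intro!: delta0_sigma1 delta0_le term_fun_intros)

lemmas sigma1_intros = sigma1_conj sigma1_disj sigma1_ex sigma1_eq sigma1_less sigma1_le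
  sigma1_fun_prod_encode sigma1_fun_Suc sigma1_fun_Var sigma1_fun_const

section \<open>Finite sets as binary expansions\<close>

lemma bit_nat_iff: "bit b u \<longleftrightarrow> (\<exists>q \<le> b. \<exists>r \<le> b. b = q * 2 ^ Suc u + 2 ^ u + r \<and> r < 2 ^ u)" for b u :: nat
proof
  assume "bit b u"
  then have "odd (b div 2 ^ u)" by (simp add: bit_iff_odd)
  then obtain q where q: "b div 2 ^ u = 2 * q + 1" by (elim oddE)
  have "b = (2 * q + 1) * 2 ^ u + b mod 2 ^ u" using q div_mult_mod_eq[of b "2 ^ u"] by simp
  then have b: "b = q * 2 ^ Suc u + 2 ^ u + b mod 2 ^ u" by (simp add: algebra_simps)
  have "q \<le> q * 2 ^ Suc u" by simp
  then have "q \<le> b" using b by linarith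
  then show "\<exists>q \<le> b. \<exists>r \<le> b. b = q * 2 ^ Suc u + 2 ^ u + r \<and> r < 2 ^ u"
    using b by (intro exI[of _ q] exI[of _ "b mod 2 ^ u"] conjI) simp_all
next
  assume "\<exists>q \<le> b. \<exists>r \<le> b. b = q * 2 ^ Suc u + 2 ^ u + r \<and> r < 2 ^ u"
  then obtain q r where b: "b = q * 2 ^ Suc u + 2 ^ u + r" and r: "r < 2 ^ u" by blast
  have "b = (2 * q + 1) * 2 ^ u + r" using b by (simp add: algebra_simps)
  moreover have "((2 * q + 1) * 2 ^ u + r) div 2 ^ u = (2 * q + 1) + r div 2 ^ u"
    by (rule div_mult_self3) simp
  ultimately have "b div 2 ^ u = 2 * q + 1" using r by (metis add.right_neutral div_less)
  then show "bit b u" by (simp add: bit_iff_odd)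
qed

text \<open>\<open>bit_nat_iff\<close> writes the set code as (2q+1) 2^u + r with r < 2^u, where q
  and r are bounded by the code. As 2^u is a term of the language, membership in a coded finite set
  is Delta0.\<close>

lemma delta0_bit: "delta0_pred (\<lambda>e. bit (e i) (e j))"
  unfolding bit_nat_iff
  by (intro delta0_conj delta0_bex delta0_eq delta0_less term_fun_intros)

lemma finite_set_bits: "finite X \<Longrightarrow> \<exists>b::nat. \<forall>p. bit b p \<longleftrightarrow> p \<in> X"
proof (induction rule: finite_induct)
  case empty
  show ?case by (intro exI[of _ 0]) simp
next
  case (insert x X)
  then obtain b :: nat where "\<forall>p. bit b p \<longleftrightarrow> p \<in> X" by blast
  then show ?case by (intro exI[of _ "set_bit x b"]) (auto simp: bit_set_bit_iff)
qed

text \<open>Allows a quantifier over the elements of a coded set to be bounded by its code, as in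
  \<open>ce1_ind_set\<close>.\<close>

lemma bit_imp_less: "bit (b::nat) p \<Longrightarrow> p < b"
proof -
  assume "bit b p"
  then obtain q r where "b = q * 2 ^ Suc p + 2 ^ p + r" using bit_nat_iff by blast
  then show ?thesis using less_exp[of p] by linarith
qed

text \<open>
  Every inductive definition below has at most two premises per rule, so a derivation is a finite set
  of pairs of a rank and a code in which each element follows from elements of smaller rank.
\<close>

inductive ind_set :: "(nat \<Rightarrow> bool) \<Rightarrow> (nat \<Rightarrow> nat \<Rightarrow> nat \<Rightarrow> bool) \<Rightarrow> nat \<Rightarrow> bool" for B S where
  base: "B z \<Longrightarrow> ind_set B S z"
| step: "ind_set B S x \<Longrightarrow> ind_set B S y \<Longrightarrow> S x y z \<Longrightarrow> ind_set B S z"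

definition derivation_step :: "(nat \<Rightarrow> bool) \<Rightarrow> (nat \<Rightarrow> nat \<Rightarrow> nat \<Rightarrow> bool) \<Rightarrow> nat set \<Rightarrow> nat \<Rightarrow> bool" where
  "derivation_step B S X p \<longleftrightarrow> (\<exists>r z. p = prod_encode (r, z) \<and> (B z \<or> (\<exists>x y r1 r2. r1 < r \<and> r2 < r \<and>
     prod_encode (r1, x) \<in> X \<and> prod_encode (r2, y) \<in> X \<and> S x y z)))"

lemma derivation_step_mono: "derivation_step B S X p \<Longrightarrow> X \<subseteq> Y \<Longrightarrow> derivation_step B S Y p"
  unfolding derivation_step_def by (elim exE disjE conjE; blast)

text \<open>The ranks exclude circular justification, so induction on the rank applies.\<close>

lemma derivation_sound:
  assumes "\<forall>p \<in> X. derivation_step B S X p"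
  shows "prod_encode (r, z) \<in> X \<Longrightarrow> ind_set B S z"
proof (induction r arbitrary: z rule: less_induct)
  case (less r)
  then have "derivation_step B S X (prod_encode (r, z))" using assms by blast
  then have "B z \<or> (\<exists>x y r1 r2. r1 < r \<and> r2 < r \<and>
     prod_encode (r1, x) \<in> X \<and> prod_encode (r2, y) \<in> X \<and> S x y z)"
    unfolding derivation_step_def by auto
  then show ?case
  proof (elim disjE exE conjE)
    assume "B z"
    then show ?thesis by (rule ind_set.base)
  next
    fix x y r1 r2 assume "r1 < r" "r2 < r" "prod_encode (r1, x) \<in> X" "prod_encode (r2, y) \<in> X" and S: "S x y z"
    then have "ind_set B S x" "ind_set B S y" using less.IH by blast+
    then show ?thesis using S by (rule ind_set.step)
  qed
qed

lemma derivation_complete: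
  "ind_set B S z \<Longrightarrow> \<exists>X r. finite X \<and> (\<forall>p \<in> X. derivation_step B S X p) \<and> prod_encode (r, z) \<in> X"
proof (induction rule: ind_set.induct)
  case (base z)
  then have "derivation_step B S {prod_encode (0, z)} (prod_encode (0, z))"
    unfolding derivation_step_def by blast
  then show ?case by (intro exI[of _ "{prod_encode (0, z)}"] exI[of _ 0]) simp
next
  case (step x y z)
  then obtain X Y r s where X: "finite X" "\<forall>p \<in> X. derivation_step B S X p" "prod_encode (r, x) \<in> X"
    and Y: "finite Y" "\<forall>p \<in> Y. derivation_step B S Y p" "prod_encode (s, y) \<in> Y" by blast
  \<comment> \<open>A rank above both premises; the union of the two derivations justifies the new
    element.\<close>
  define t where "t = Suc (max r s)"
  define Z where "Z = insert (prod_encode (t, z)) (X \<union> Y)"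
  have "r < t" "s < t" "prod_encode (r, x) \<in> Z" "prod_encode (s, y) \<in> Z"
    using X(3) Y(3) by (auto simp: t_def Z_def)
  then have "derivation_step B S Z (prod_encode (t, z))"
    unfolding derivation_step_def using step.hyps(3) by blast
  moreover have "derivation_step B S Z p" if "p \<in> X \<or> p \<in> Y" for p
    using that
  proof
    assume "p \<in> X"
    then show ?thesis using X(2) derivation_step_mono[of B S X p Z] by (auto simp: Z_def)
  next
    assume "p \<in> Y"
    then show ?thesis using Y(2) derivation_step_mono[of B S Y p Z] by (auto simp: Z_def)
  qed
  ultimately have "\<forall>p \<in> Z. derivation_step B S Z p" by (auto simp: Z_def)
  moreover have "finite Z" "prod_encode (t, z) \<in> Z" using X(1) Y(1) by (auto simp: Z_def)
  ultimately show ?case by blast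
qed

text \<open>The derivation is guessed as a number \<open>b\<close>. The quantifier over its elements
  is bounded by \<open>b\<close> and has a Sigma1 body, so collection
  (\<open>sigma1_ball_term\<close>) applies; everything in front is existential.\<close>

lemma ce1_ind_set:
  assumes "ce1 B" "ce3 S"
  shows "ce1 (ind_set B S)"
proof -
  have eq: "ind_set B S z \<longleftrightarrow> (\<exists>b r. bit b (prod_encode (r, z)) \<and> (\<forall>p \<le> b. \<not> bit b p \<or>
     (\<exists>r z. p = prod_encode (r, z) \<and> (B z \<or> (\<exists>x y r1 r2. r1 < r \<and> r2 < r \<and>
       bit b (prod_encode (r1, x)) \<and> bit b (prod_encode (r2, y)) \<and> S x y z)))))"
    (is "_ \<longleftrightarrow> (\<exists>b r. _ \<and> (\<forall>p \<le> b. _ \<or> ?D b p))") for z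
  proof -
    have D: "?D b p \<longleftrightarrow> derivation_step B S {p. bit b p} p" for b p :: nat
      unfolding derivation_step_def by simp
    have "ind_set B S z" if "bit b (prod_encode (r, z))" "\<forall>p \<le> b. \<not> bit b p \<or> ?D b p" for b r :: nat
    proof (rule derivation_sound[of "{p. bit b p}"])
      show "\<forall>p \<in> {p. bit b p}. derivation_step B S {p. bit b p} p"
        using that(2) bit_imp_less[of b] unfolding D by (auto simp: less_imp_le)
      show "prod_encode (r, z) \<in> {p. bit b p}" using that(1) by simp
    qed
    moreover have "\<exists>b r. bit b (prod_encode (r, z)) \<and> (\<forall>p \<le> b. \<not> bit b p \<or> ?D b p)" if z: "ind_set B S z"
    proof -
      obtain X r where X: "finite X" "\<forall>p \<in> X. derivation_step B S X p" "prod_encode (r, z) \<in> X"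
        using derivation_complete[OF z] by blast
      then obtain b :: nat where b: "\<forall>p. bit b p \<longleftrightarrow> p \<in> X" using finite_set_bits by blast
      then have "X = {p. bit b p}" by auto
      then have "bit b (prod_encode (r, z)) \<and> (\<forall>p \<le> b. \<not> bit b p \<or> ?D b p)"
        unfolding D using X(2,3) by simp
      then show ?thesis by blast
    qed
    ultimately show ?thesis by blast
  qed
  have bit: "ce2 (\<lambda>b p. bit b p)" and nbit: "ce2 (\<lambda>b p. \<not> bit b p)"
    unfolding ce2_def by (intro delta0_sigma1 delta0_not delta0_bit)+
  show ?thesis unfolding ce1_def eq
    by (intro sigma1_intros ce2_app[OF bit] sigma1_ball_term ce2_app[OF nbit] ce1_app[OF assms(1)]
        ce3_app[OF assms(2)] term_fun_Var)
qed

section \<open>Coded syntax and provability\<close>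

lemma codeT_inj: "codeT t = codeT s \<longleftrightarrow> t = s"
proof (induction t arbitrary: s)
qed (case_tac s; simp)+

lemma codeF_inj: "codeF A = codeF B \<longleftrightarrow> A = B"
proof (induction A arbitrary: B)
qed (case_tac B; simp add: codeT_inj)+

text \<open>
  A family of substitutions indexed by parameters \<open>p\<close>: the relation \<open>V\<close> gives the coded values on
  variables, and \<open>Up\<close> is the change of parameter on entering a quantifier. Lifting (\<open>p = k\<close>) and
  single substitution (\<open>p\<close> a coded pair of \<open>k\<close> and the term) are instances.
\<close>

locale coded_substitution =
  fixes ok :: "nat \<Rightarrow> bool" and \<sigma> :: "nat \<Rightarrow> nat \<Rightarrow> trm"
    and V :: "nat \<Rightarrow> nat \<Rightarrow> nat \<Rightarrow> bool" and Up :: "nat \<Rightarrow> nat \<Rightarrow> bool"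
  assumes ce_ok: "ce1 ok" and ce_V: "ce3 V" and ce_Up: "ce2 Up"
    and V_iff: "\<And>p i v. V p i v \<longleftrightarrow> ok p \<and> v = codeT (\<sigma> p i)"
    and Up_ok: "\<And>p q. ok p \<Longrightarrow> Up p q \<Longrightarrow> ok q"
    and Up_up: "\<And>p q. ok p \<Longrightarrow> Up p q \<Longrightarrow> \<sigma> q = up (\<sigma> p)"
    and Up_ex: "\<And>p. ok p \<Longrightarrow> \<exists>q. Up p q"
begin

definition subT :: "nat \<Rightarrow> nat \<Rightarrow> nat \<Rightarrow> bool" where
  "subT p a a' \<longleftrightarrow> ok p \<and> (\<exists>t. a = codeT t \<and> a' = codeT (psubT (\<sigma> p) t))"

definition subF :: "nat \<Rightarrow> nat \<Rightarrow> nat \<Rightarrow> bool" where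
  "subF p a a' \<longleftrightarrow> ok p \<and> (\<exists>A. a = codeF A \<and> a' = codeF (psubF (\<sigma> p) A))"

text \<open>The derived objects are triples of a parameter, the code of a term and the code of the
  substituted term. The tags 0 to 5 in \<open>baseT\<close> and \<open>stepT\<close> are those of
  \<open>codeT\<close>.\<close>

definition baseT :: "nat \<Rightarrow> bool" where
  "baseT z \<longleftrightarrow> (\<exists>p i v. V p i v \<and> z = prod_encode (p, prod_encode (prod_encode (0, i), v)))
     \<or> (\<exists>p. ok p \<and> z = prod_encode (p, prod_encode (prod_encode (1, 0), prod_encode (1, 0))))"

definition stepT :: "nat \<Rightarrow> nat \<Rightarrow> nat \<Rightarrow> bool" where
  "stepT x y z \<longleftrightarrow> (\<exists>p a a' b b'. x = prod_encode (p, prod_encode (a, a')) \<and> y = prod_encode (p, prod_encode (b, b')) \<and>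
     (z = prod_encode (p, prod_encode (prod_encode (2, a), prod_encode (2, a'))) \<or>
      z = prod_encode (p, prod_encode (prod_encode (5, a), prod_encode (5, a'))) \<or>
      z = prod_encode (p, prod_encode (prod_encode (3, prod_encode (a, b)), prod_encode (3, prod_encode (a', b')))) \<or>
      z = prod_encode (p, prod_encode (prod_encode (4, prod_encode (a, b)), prod_encode (4, prod_encode (a', b'))))))"

lemma ce1_baseT: "ce1 baseT"
  unfolding ce1_def baseT_def by (intro sigma1_intros ce3_app[OF ce_V] ce1_app[OF ce_ok])

lemma ce3_stepT: "ce3 stepT"
  unfolding ce3_def stepT_def by (intro sigma1_intros)

lemma ind_set_subT: "ind_set baseT stepT (prod_encode (p, prod_encode (a, a'))) \<longleftrightarrow> subT p a a'"
proof
  have "\<exists>p a a'. z = prod_encode (p, prod_encode (a, a')) \<and> subT p a a'" if "ind_set baseT stepT z" for z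
    using that
  proof (induction rule: ind_set.induct)
    case (base z)
    then consider p i v where "V p i v" "z = prod_encode (p, prod_encode (prod_encode (0, i), v))"
      | p where "ok p" "z = prod_encode (p, prod_encode (prod_encode (1, 0), prod_encode (1, 0)))"
      unfolding baseT_def by blast
    then show ?case
    proof cases
      case 1
      then have "subT p (codeT (Var i)) v" unfolding subT_def V_iff by (intro conjI exI[of _ "Var i"]) auto
      then show ?thesis using 1 by auto
    next
      case 2
      then have "subT p (codeT Zr) (codeT Zr)" unfolding subT_def by (intro conjI exI[of _ Zr]) auto
      then show ?thesis using 2 by auto
    qed
  next
    case (step x y z)
    then obtain p a a' b b' where x: "x = prod_encode (p, prod_encode (a, a'))"
      and y: "y = prod_encode (p, prod_encode (b, b'))" and
      z: "z = prod_encode (p, prod_encode (prod_encode (2, a), prod_encode (2, a'))) \<or>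
      z = prod_encode (p, prod_encode (prod_encode (5, a), prod_encode (5, a'))) \<or>
      z = prod_encode (p, prod_encode (prod_encode (3, prod_encode (a, b)), prod_encode (3, prod_encode (a', b')))) \<or>
      z = prod_encode (p, prod_encode (prod_encode (4, prod_encode (a, b)), prod_encode (4, prod_encode (a', b'))))"
      unfolding stepT_def by blast
    have "subT p a a'" "subT p b b'" using step.IH x y by auto
    then obtain t s where ts: "ok p" "a = codeT t" "a' = codeT (psubT (\<sigma> p) t)" "b = codeT s" "b' = codeT (psubT (\<sigma> p) s)"
      unfolding subT_def by blast
    have *: "subT p (codeT u) (codeT (psubT (\<sigma> p) u))" for u using ts(1) unfolding subT_def by blast
    show ?case using z *[of "Sc t"] *[of "Ex2 t"] *[of "Pl t s"] *[of "Tm t s"] ts by auto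
  qed
  then show "ind_set baseT stepT (prod_encode (p, prod_encode (a, a'))) \<Longrightarrow> subT p a a'" by fastforce
next
  assume "subT p a a'"
  then obtain t where "ok p" and a: "a = codeT t" "a' = codeT (psubT (\<sigma> p) t)" unfolding subT_def by blast
  have "ind_set baseT stepT (prod_encode (p, prod_encode (codeT t, codeT (psubT (\<sigma> p) t))))"
  proof (induction t)
    case (Var i)
    have "V p i (codeT (\<sigma> p i))" using V_iff \<open>ok p\<close> by blast
    then show ?case by (intro ind_set.base) (auto simp: baseT_def)
  next
    case Zr
    show ?case by (rule ind_set.base) (use \<open>ok p\<close> in \<open>auto simp: baseT_def\<close>)
  next
    case (Sc t)
    show ?case by (rule ind_set.step[OF Sc Sc]) (auto simp: stepT_def)
  next
    case (Ex2 t)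
    show ?case by (rule ind_set.step[OF Ex2 Ex2]) (auto simp: stepT_def)
  next
    case (Pl t s)
    show ?case by (rule ind_set.step[OF Pl]) (auto simp: stepT_def)
  next
    case (Tm t s)
    show ?case by (rule ind_set.step[OF Tm]) (auto simp: stepT_def)
  qed
  then show "ind_set baseT stepT (prod_encode (p, prod_encode (a, a')))" using a by simp
qed

lemma ce3_subT: "ce3 subT"
  unfolding ce3_def ind_set_subT[symmetric]
  by (intro sigma1_intros ce1_app[OF ce1_ind_set[OF ce1_baseT ce3_stepT]])

definition baseF :: "nat \<Rightarrow> bool" where
  "baseF z \<longleftrightarrow> (\<exists>p. ok p \<and> z = prod_encode (p, prod_encode (prod_encode (0, 0), prod_encode (0, 0))))
     \<or> (\<exists>p a a' b b'. subT p a a' \<and> subT p b b' \<and>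
        (z = prod_encode (p, prod_encode (prod_encode (1, prod_encode (a, b)), prod_encode (1, prod_encode (a', b')))) \<or>
         z = prod_encode (p, prod_encode (prod_encode (2, prod_encode (a, b)), prod_encode (2, prod_encode (a', b'))))))"

text \<open>The quantifier rule constrains one premise, which is derived for the parameter obtained
  by \<open>Up\<close>; the second premise may be anything derived.\<close>

definition stepF :: "nat \<Rightarrow> nat \<Rightarrow> nat \<Rightarrow> bool" where
  "stepF x y z \<longleftrightarrow> (\<exists>p a a' b b'. x = prod_encode (p, prod_encode (a, a')) \<and> y = prod_encode (p, prod_encode (b, b')) \<and>
      z = prod_encode (p, prod_encode (prod_encode (3, prod_encode (a, b)), prod_encode (3, prod_encode (a', b'))))) \<or>
     (\<exists>p q a a'. ok p \<and> Up p q \<and> x = prod_encode (q, prod_encode (a, a')) \<and>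
      z = prod_encode (p, prod_encode (prod_encode (4, a), prod_encode (4, a'))))"

lemma ce1_baseF: "ce1 baseF"
  unfolding ce1_def baseF_def by (intro sigma1_intros ce3_app[OF ce3_subT] ce1_app[OF ce_ok])

lemma ce3_stepF: "ce3 stepF"
  unfolding ce3_def stepF_def by (intro sigma1_intros ce2_app[OF ce_Up] ce1_app[OF ce_ok])

lemma ind_set_subF: "ind_set baseF stepF (prod_encode (p, prod_encode (a, a'))) \<longleftrightarrow> subF p a a'"
proof
  have *: "subF p (codeF A) (codeF (psubF (\<sigma> p) A))" if "ok p" for p A
    using that unfolding subF_def by blast
  have "\<exists>p a a'. z = prod_encode (p, prod_encode (a, a')) \<and> subF p a a'" if "ind_set baseF stepF z" for z
    using that
  proof (induction rule: ind_set.induct)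
    case (base z)
    then consider p where "ok p" "z = prod_encode (p, prod_encode (prod_encode (0, 0), prod_encode (0, 0)))"
      | p t s where "ok p" "z = prod_encode (p, prod_encode (codeF (Eqt t s), codeF (psubF (\<sigma> p) (Eqt t s)))) \<or>
         z = prod_encode (p, prod_encode (codeF (Leq t s), codeF (psubF (\<sigma> p) (Leq t s))))"
      unfolding baseF_def subT_def by auto
    then show ?case
    proof cases
      case 1
      then show ?thesis using *[of p Fls] by auto
    next
      case 2
      then show ?thesis using *[of p "Eqt t s"] *[of p "Leq t s"] by blast
    qed
  next
    case (step x y z)
    then consider p a a' b b' where "x = prod_encode (p, prod_encode (a, a'))" "y = prod_encode (p, prod_encode (b, b'))" 
       "z = prod_encode (p, prod_encode (prod_encode (3, prod_encode (a, b)), prod_encode (3, prod_encode (a', b'))))"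
     | p q a a' where "ok p" "Up p q" "x = prod_encode (q, prod_encode (a, a'))"
        "z = prod_encode (p, prod_encode (prod_encode (4, a), prod_encode (4, a')))"
      unfolding stepF_def by blast
    then show ?case
    proof cases
      case 1
      have "subF p a a'" "subF p b b'" using step.IH 1 by auto
      then obtain A B where "ok p" "a = codeF A" "a' = codeF (psubF (\<sigma> p) A)" "b = codeF B" "b' = codeF (psubF (\<sigma> p) B)"
        unfolding subF_def by blast
      then show ?thesis using 1(3) *[of p "Imp A B"] by auto
    next
      case 2
      have "subF q a a'" using step.IH 2 by auto
      then obtain A where "a = codeF A" "a' = codeF (psubF (\<sigma> q) A)" unfolding subF_def by blast
      then show ?thesis using 2 *[of p "Forall A"] Up_up[of p q] by auto
    qed
  qed
  then show "ind_set baseF stepF (prod_encode (p, prod_encode (a, a'))) \<Longrightarrow> subF p a a'" by fastforce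
next
  assume "subF p a a'"
  then obtain A where "ok p" and a: "a = codeF A" "a' = codeF (psubF (\<sigma> p) A)" unfolding subF_def by blast
  from \<open>ok p\<close> have "ind_set baseF stepF (prod_encode (p, prod_encode (codeF A, codeF (psubF (\<sigma> p) A))))"
  proof (induction A arbitrary: p)
    case Fls
    then show ?case by (intro ind_set.base) (auto simp: baseF_def)
  next
    case (Eqt t s)
    have "subT p (codeT t) (codeT (psubT (\<sigma> p) t))" "subT p (codeT s) (codeT (psubT (\<sigma> p) s))"
      using Eqt unfolding subT_def by blast+
    then have "baseF (prod_encode (p, prod_encode (codeF (Eqt t s), codeF (psubF (\<sigma> p) (Eqt t s)))))"
      unfolding baseF_def by auto
    then show ?case by (rule ind_set.base)
  next
    case (Leq t s)
    have "subT p (codeT t) (codeT (psubT (\<sigma> p) t))" "subT p (codeT s) (codeT (psubT (\<sigma> p) s))"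
      using Leq unfolding subT_def by blast+
    then have "baseF (prod_encode (p, prod_encode (codeF (Leq t s), codeF (psubF (\<sigma> p) (Leq t s)))))"
      unfolding baseF_def by auto
    then show ?case by (rule ind_set.base)
  next
    case (Imp A B)
    show ?case
      by (rule ind_set.step[OF Imp.IH(1)[OF Imp.prems] Imp.IH(2)[OF Imp.prems]]) (auto simp: stepF_def)
  next
    case (Forall A)
    obtain q where q: "Up p q" using Up_ex Forall.prems by blast
    note IH = Forall.IH[OF Up_ok[OF Forall.prems q]]
    show ?case
      by (rule ind_set.step[OF IH IH]) (use q Forall.prems Up_up in \<open>auto simp: stepF_def\<close>)
  qed
  then show "ind_set baseF stepF (prod_encode (p, prod_encode (a, a')))" using a by simp
qed

lemma ce3_subF: "ce3 subF"
  unfolding ce3_def ind_set_subF[symmetric]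
  by (intro sigma1_intros ce1_app[OF ce1_ind_set[OF ce1_baseF ce3_stepF]])

end

section \<open>Coded lifting, instantiation and numerals\<close>

definition lift_code_var :: "nat \<Rightarrow> nat \<Rightarrow> nat \<Rightarrow> bool" where
  "lift_code_var k i v \<longleftrightarrow> (i < k \<and> v = prod_encode (0, i)) \<or> (k \<le> i \<and> v = prod_encode (0, Suc i))"

lemma coded_lift: "coded_substitution (\<lambda>_. True) lift_var lift_code_var (\<lambda>p q. q = Suc p)"
proof
  show "ce1 (\<lambda>_. True)"
    using sigma1_eq[of "\<lambda>e. 0" "\<lambda>e. 0"] by (simp add: ce1_def sigma1_fun_const)
  show "ce3 lift_code_var"
    unfolding ce3_def lift_code_var_def by (intro sigma1_intros)
  show "ce2 (\<lambda>p q. q = Suc p)"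
    unfolding ce2_def by (intro sigma1_intros)
qed (auto simp: lift_code_var_def lift_var_def up_lift_var)

definition lift_code :: "nat \<Rightarrow> nat \<Rightarrow> bool" where
  "lift_code a b \<longleftrightarrow> (\<exists>A. a = codeF A \<and> b = codeF (liftF 0 A))"

definition lift_codeT :: "nat \<Rightarrow> nat \<Rightarrow> bool" where
  "lift_codeT a b \<longleftrightarrow> (\<exists>t. a = codeT t \<and> b = codeT (liftT 0 t))"

lemma ce2_lift_codeT: "ce2 lift_codeT"
proof -
  interpret coded_substitution "\<lambda>_. True" lift_var lift_code_var "\<lambda>p q. q = Suc p" by (rule coded_lift)
  have "lift_codeT a b \<longleftrightarrow> subT 0 a b" for a b
    unfolding lift_codeT_def subT_def liftT_eq_psubT by simp
  then show ?thesis unfolding ce2_def by (simp only:) (intro ce3_app[OF ce3_subT] sigma1_intros)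
qed

lemma ce2_lift_code: "ce2 lift_code"
proof -
  interpret coded_substitution "\<lambda>_. True" lift_var lift_code_var "\<lambda>p q. q = Suc p" by (rule coded_lift)
  have "lift_code a b \<longleftrightarrow> subF 0 a b" for a b
    unfolding lift_code_def subF_def liftF_eq_psubF by simp
  then show ?thesis unfolding ce2_def by (simp only:) (intro ce3_app[OF ce3_subF] sigma1_intros)
qed

definition is_trm :: "nat \<Rightarrow> bool" where "is_trm a \<longleftrightarrow> (\<exists>t. a = codeT t)"
definition is_fm :: "nat \<Rightarrow> bool" where "is_fm a \<longleftrightarrow> (\<exists>A. a = codeF A)"

text \<open>Well-formedness is read off from the lifting relation, whose domain is exactly the set
  of term codes; \<open>ce1_is_fm\<close> does the same for formulas.\<close>

lemma ce1_is_trm: "ce1 is_trm"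
proof -
  have "is_trm a \<longleftrightarrow> (\<exists>b. lift_codeT a b)" for a
    unfolding is_trm_def lift_codeT_def by blast
  then show ?thesis unfolding ce1_def by (simp only:) (intro ce2_app[OF ce2_lift_codeT] sigma1_intros)
qed

lemma ce1_is_fm: "ce1 is_fm"
proof -
  have "is_fm a \<longleftrightarrow> (\<exists>b. lift_code a b)" for a
    unfolding is_fm_def lift_code_def by blast
  then show ?thesis unfolding ce1_def by (simp only:) (intro ce2_app[OF ce2_lift_code] sigma1_intros)
qed

definition subst_ok :: "nat \<Rightarrow> bool" where
  "subst_ok p \<longleftrightarrow> (\<exists>k u. p = prod_encode (k, u) \<and> is_trm u)"

text \<open>The lowered index is given as the \<open>j\<close> with \<open>i = Suc j\<close>, which
  keeps the relation within the Sigma1 closure operations.\<close>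

definition subst_code_var :: "nat \<Rightarrow> nat \<Rightarrow> nat \<Rightarrow> bool" where
  "subst_code_var p i v \<longleftrightarrow> (\<exists>k u. p = prod_encode (k, u) \<and> is_trm u \<and>
     ((i < k \<and> v = prod_encode (0, i)) \<or> (i = k \<and> v = u) \<or> (\<exists>j. i = Suc j \<and> k < i \<and> v = prod_encode (0, j))))"

definition subst_up :: "nat \<Rightarrow> nat \<Rightarrow> bool" where
  "subst_up p q \<longleftrightarrow> (\<exists>k u u'. p = prod_encode (k, u) \<and> lift_codeT u u' \<and> q = prod_encode (Suc k, u'))"

definition subst_of_code :: "nat \<Rightarrow> nat \<Rightarrow> trm" where
  "subst_of_code p = (case prod_decode p of (k, u) \<Rightarrow> subst_var k (inv codeT u))"

lemma inv_codeT [simp]: "inv codeT (codeT t) = t"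
  by (rule inv_f_f) (auto simp: inj_def codeT_inj)

lemma coded_subst: "coded_substitution subst_ok subst_of_code subst_code_var subst_up"
proof
  show "ce1 subst_ok"
    unfolding ce1_def subst_ok_def by (intro sigma1_intros ce1_app[OF ce1_is_trm])
  show "ce3 subst_code_var"
    unfolding ce3_def subst_code_var_def by (intro sigma1_intros ce1_app[OF ce1_is_trm])
  show "ce2 subst_up"
    unfolding ce2_def subst_up_def by (intro sigma1_intros ce2_app[OF ce2_lift_codeT])
  show "subst_code_var p i v \<longleftrightarrow> subst_ok p \<and> v = codeT (subst_of_code p i)" for p i v
  proof -
    obtain k u where p: "p = prod_encode (k, u)" by (metis prod_decode_inverse surj_pair)
    have "(\<exists>j. i = Suc j \<and> k < i \<and> v = prod_encode (0, j)) \<longleftrightarrow> k < i \<and> v = prod_encode (0, i - 1)"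
      by (cases i) auto
    then show ?thesis unfolding subst_code_var_def subst_ok_def subst_of_code_def p is_trm_def
      by (auto simp: subst_var_def)
  qed
qed (auto simp: subst_ok_def subst_up_def is_trm_def lift_codeT_def subst_of_code_def up_subst_var codeT_inj)

definition inst_code :: "nat \<Rightarrow> nat \<Rightarrow> nat \<Rightarrow> bool" where
  "inst_code a u b \<longleftrightarrow> (\<exists>A t. a = codeF A \<and> u = codeT t \<and> b = codeF (inst A t))"

lemma ce3_inst_code: "ce3 inst_code"
proof -
  interpret coded_substitution subst_ok subst_of_code subst_code_var subst_up by (rule coded_subst)
  have "inst_code a u b \<longleftrightarrow> subF (prod_encode (0, u)) a b" for a u b
    unfolding inst_code_def subF_def inst_def substF_eq_psubF subst_ok_def is_trm_def subst_of_code_def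
    by (auto simp: codeF_inj codeT_inj)
  then show ?thesis unfolding ce3_def by (simp only:) (intro ce3_app[OF ce3_subF] sigma1_intros)
qed

definition num_code :: "nat \<Rightarrow> nat \<Rightarrow> bool" where
  "num_code n c \<longleftrightarrow> c = codeT (num n)"

lemma ce2_num_code: "ce2 num_code"
proof -
  define B where "B z \<longleftrightarrow> z = prod_encode (0, prod_encode (1, 0))" for z
  define S where "S x y z \<longleftrightarrow> (\<exists>n c. x = prod_encode (n, c) \<and> z = prod_encode (Suc n, prod_encode (2, c)))"
    for x y z :: nat
  have "ce1 B" unfolding ce1_def B_def by (intro sigma1_intros)
  moreover have "ce3 S" unfolding ce3_def S_def by (intro sigma1_intros)
  ultimately have ce: "ce1 (ind_set B S)" by (rule ce1_ind_set)
  have "ind_set B S (prod_encode (n, codeT (num n)))" for n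
  proof (induction n)
    case 0
    show ?case by (rule ind_set.base) (simp add: B_def)
  next
    case (Suc n)
    show ?case by (rule ind_set.step[OF Suc Suc]) (simp add: S_def)
  qed
  moreover have "\<exists>n. z = prod_encode (n, codeT (num n))" if "ind_set B S z" for z
    using that
  proof (induction rule: ind_set.induct)
    case (base z)
    then show ?case by (intro exI[of _ 0]) (simp add: B_def)
  next
    case (step x y z)
    then obtain n where "x = prod_encode (n, codeT (num n))" by blast
    then show ?case using step.hyps(3) by (intro exI[of _ "Suc n"]) (auto simp: S_def)
  qed
  ultimately have "num_code n c \<longleftrightarrow> ind_set B S (prod_encode (n, c))" for n c
    unfolding num_code_def by fastforce
  then show ?thesis unfolding ce2_def by (simp only:) (intro ce1_app[OF ce] sigma1_intros)
qed

lemma Sigma1_sigma1_pred: "Sigma1 A \<Longrightarrow> sigma1_pred (\<lambda>e. evalF e A)"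
proof (induction rule: Sigma1.induct)
  case (1 A)
  then show ?case by (intro delta0_sigma1) (auto simp: delta0_pred_def)
next
  case (2 A)
  have "(\<lambda>i. case_nat (e 0) (\<lambda>i. e (Suc i)) i) = e" for e :: "nat \<Rightarrow> nat"
    by (auto split: nat.splits)
  then have "sigma1_pred (\<lambda>e. \<exists>n. evalF (case_nat n e) A)"
    using 2 by (intro sigma1_ex) simp
  then show ?case by simp
qed

lemma ce1_theory:
  assumes "ce_theory U"
  shows "ce1 (\<lambda>n. n \<in> codeF ` U)"
proof -
  obtain \<sigma> where \<sigma>: "Sigma1 \<sigma>" "closedF 1 \<sigma>" "\<And>n. n \<in> codeF ` U \<longleftrightarrow> evalF (\<lambda>_. 0) (inst \<sigma> (num n))"
    using assms unfolding ce_theory_def by blast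
  have "evalF (\<lambda>_. 0) (inst \<sigma> (num (e 0))) = evalF e \<sigma>" for e
    unfolding inst_eq_psubF evalF_psubF by (rule evalF_cong_closed[OF \<sigma>(2)]) simp
  then show ?thesis unfolding ce1_def \<sigma>(3) using Sigma1_sigma1_pred[OF \<sigma>(1)] by simp
qed

section \<open>Coded provability\<close>

definition prov_code :: "fm set \<Rightarrow> nat \<Rightarrow> bool" where
  "prov_code U c \<longleftrightarrow> (\<exists>A. c = codeF A \<and> proves U A)"

abbreviation imp_code :: "nat \<Rightarrow> nat \<Rightarrow> nat" where
  "imp_code a b \<equiv> prod_encode (3, prod_encode (a, b))"

abbreviation all_code :: "nat \<Rightarrow> nat" where
  "all_code a \<equiv> prod_encode (4, a)"

abbreviation eq_code :: "nat \<Rightarrow> nat \<Rightarrow> nat" where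
  "eq_code a b \<equiv> prod_encode (1, prod_encode (a, b))"

text \<open>One disjunct for membership in \<open>U\<close> and one for each axiom scheme of
  \<open>proves\<close>; \<open>inst_code\<close> and \<open>lift_code\<close> already restrict
  their arguments to codes.\<close>

definition axiom_code :: "fm set \<Rightarrow> nat \<Rightarrow> bool" where
  "axiom_code U z \<longleftrightarrow> z \<in> codeF ` U
   \<or> (\<exists>a b. is_fm a \<and> is_fm b \<and> z = imp_code a (imp_code b a))
   \<or> (\<exists>a b c. is_fm a \<and> is_fm b \<and> is_fm c \<and>
        z = imp_code (imp_code a (imp_code b c)) (imp_code (imp_code a b) (imp_code a c)))
   \<or> (\<exists>a. is_fm a \<and> z = imp_code (imp_code (imp_code a (prod_encode (0, 0))) (prod_encode (0, 0))) a)
   \<or> (\<exists>a t b. inst_code a t b \<and> z = imp_code (all_code a) b)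
   \<or> (\<exists>a a' b. lift_code a a' \<and> is_fm b \<and> z = imp_code (all_code (imp_code a' b)) (imp_code a (all_code b)))
   \<or> (\<exists>t. is_trm t \<and> z = eq_code t t)
   \<or> (\<exists>t s a b c. inst_code a t b \<and> inst_code a s c \<and> z = imp_code (eq_code t s) (imp_code b c))"

text \<open>The rule is applied to codes of theorems, so its conclusion is again the code of a
  formula; \<open>prov_code_iff\<close> recovers that formula by decomposing the code
  \<open>x\<close>.\<close>

definition rule_code :: "nat \<Rightarrow> nat \<Rightarrow> nat \<Rightarrow> bool" where
  "rule_code x y z \<longleftrightarrow> x = imp_code y z \<or> z = all_code x"

lemma axiom_code_sound: "axiom_code U z \<Longrightarrow> prov_code U z"
  unfolding axiom_code_def
proof (elim disjE exE conjE)
  assume "z \<in> codeF ` U"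
  then show ?thesis unfolding prov_code_def using proves.hyp by blast
next
  fix a b assume "is_fm a" "is_fm b" "z = imp_code a (imp_code b a)"
  then obtain A B where "z = codeF (Imp A (Imp B A))" unfolding is_fm_def by auto
  then show ?thesis unfolding prov_code_def using axK by blast
next
  fix a b c assume "is_fm a" "is_fm b" "is_fm c"
    "z = imp_code (imp_code a (imp_code b c)) (imp_code (imp_code a b) (imp_code a c))"
  then obtain A B C where "z = codeF (Imp (Imp A (Imp B C)) (Imp (Imp A B) (Imp A C)))"
    unfolding is_fm_def by auto
  then show ?thesis unfolding prov_code_def using axS by blast
next
  fix a assume "is_fm a" "z = imp_code (imp_code (imp_code a (prod_encode (0, 0))) (prod_encode (0, 0))) a"
  then obtain A where "z = codeF (Imp (Imp (Imp A Fls) Fls) A)" unfolding is_fm_def by auto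
  then show ?thesis unfolding prov_code_def using axDN by blast
next
  fix a t b assume "inst_code a t b" "z = imp_code (all_code a) b"
  then obtain A u where "z = codeF (Imp (Forall A) (inst A u))" unfolding inst_code_def by auto
  then show ?thesis unfolding prov_code_def using axInst by blast
next
  fix a a' b assume "lift_code a a'" "is_fm b" "z = imp_code (all_code (imp_code a' b)) (imp_code a (all_code b))"
  then obtain A B where "z = codeF (Imp (Forall (Imp (liftF 0 A) B)) (Imp A (Forall B)))"
    unfolding lift_code_def is_fm_def by auto
  then show ?thesis unfolding prov_code_def using axAllImp by blast
next
  fix t assume "is_trm t" "z = eq_code t t"
  then obtain u where "z = codeF (Eqt u u)" unfolding is_trm_def by auto
  then show ?thesis unfolding prov_code_def using axRefl by blast
next
  fix t s a b c assume "inst_code a t b" "inst_code a s c" "z = imp_code (eq_code t s) (imp_code b c)"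
  then obtain A u v where "z = codeF (Imp (Eqt u v) (Imp (inst A u) (inst A v)))"
    unfolding inst_code_def by (auto simp: codeF_inj)
  then show ?thesis unfolding prov_code_def using axLeib by blast
qed

lemma prov_code_iff: "prov_code U z \<longleftrightarrow> ind_set (axiom_code U) rule_code z"
proof
  assume "prov_code U z"
  then obtain A where z: "z = codeF A" and "proves U A" unfolding prov_code_def by blast
  from this(2) have "ind_set (axiom_code U) rule_code (codeF A)"
  proof (induction U A rule: proves.induct)
    case (mp \<Gamma> A B)
    show ?case by (rule ind_set.step[OF mp.IH]) (simp add: rule_code_def)
  next
    case (gen \<Gamma> A)
    show ?case by (rule ind_set.step[OF gen.IH gen.IH]) (simp add: rule_code_def)
  next
    case (hyp A \<Gamma>)
    then show ?case by (intro ind_set.base) (simp add: axiom_code_def)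
  next
    case (axK \<Gamma> A B)
    have "is_fm (codeF A)" "is_fm (codeF B)" unfolding is_fm_def by blast+
    then have "axiom_code \<Gamma> (codeF (Imp A (Imp B A)))" unfolding axiom_code_def codeF.simps by blast
    then show ?case by (rule ind_set.base)
  next
    case (axS \<Gamma> A B C)
    have "is_fm (codeF A)" "is_fm (codeF B)" "is_fm (codeF C)" unfolding is_fm_def by blast+
    then have "axiom_code \<Gamma> (codeF (Imp (Imp A (Imp B C)) (Imp (Imp A B) (Imp A C))))"
      unfolding axiom_code_def codeF.simps by blast
    then show ?case by (rule ind_set.base)
  next
    case (axDN \<Gamma> A)
    have "is_fm (codeF A)" unfolding is_fm_def by blast+
    then have "axiom_code \<Gamma> (codeF (Imp (Imp (Imp A Fls) Fls) A))"
      unfolding axiom_code_def codeF.simps by blast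
    then show ?case by (rule ind_set.base)
  next
    case (axInst \<Gamma> A t)
    have "inst_code (codeF A) (codeT t) (codeF (inst A t))" unfolding inst_code_def by blast+
    then have "axiom_code \<Gamma> (codeF (Imp (Forall A) (inst A t)))"
      unfolding axiom_code_def codeF.simps by blast
    then show ?case by (rule ind_set.base)
  next
    case (axAllImp \<Gamma> A B)
    have "lift_code (codeF A) (codeF (liftF 0 A))" "is_fm (codeF B)" unfolding lift_code_def is_fm_def by blast+
    then have "axiom_code \<Gamma> (codeF (Imp (Forall (Imp (liftF 0 A) B)) (Imp A (Forall B))))"
      unfolding axiom_code_def codeF.simps by blast
    then show ?case by (rule ind_set.base)
  next
    case (axRefl \<Gamma> t)
    have "is_trm (codeT t)" unfolding is_trm_def by blast+
    then have "axiom_code \<Gamma> (codeF (Eqt t t))"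
      unfolding axiom_code_def codeF.simps by blast
    then show ?case by (rule ind_set.base)
  next
    case (axLeib \<Gamma> t s A)
    have "inst_code (codeF A) (codeT t) (codeF (inst A t))" "inst_code (codeF A) (codeT s) (codeF (inst A s))"
      unfolding inst_code_def by blast+
    then have "axiom_code \<Gamma> (codeF (Imp (Eqt t s) (Imp (inst A t) (inst A s))))"
      unfolding axiom_code_def codeF.simps by blast
    then show ?case by (rule ind_set.base)
  qed
  then show "ind_set (axiom_code U) rule_code z" using z by simp
next
  assume "ind_set (axiom_code U) rule_code z"
  then show "prov_code U z"
  proof (induction rule: ind_set.induct)
    case (base z)
    then show ?case by (rule axiom_code_sound)
  next
    case (step x y z)
    then obtain A B where A: "x = codeF A" "proves U A" and B: "y = codeF B" "proves U B"
      unfolding prov_code_def by blast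
    show ?case
    proof (cases "z = all_code x")
      case True
      then have "z = codeF (Forall A)" using A by simp
      then show ?thesis unfolding prov_code_def using proves.gen[OF A(2)] by blast
    next
      case False
      then have "codeF A = imp_code (codeF B) z" using step.hyps(3) A B by (simp add: rule_code_def)
      then obtain C where "A = Imp B C" "z = codeF C" by (cases A) (auto simp: codeF_inj)
      then show ?thesis unfolding prov_code_def using A B proves.mp by blast
    qed
  qed
qed

lemma ce1_prov_code:
  assumes "ce_theory U"
  shows "ce1 (prov_code U)"
proof -
  have "ce1 (axiom_code U)"
    unfolding ce1_def axiom_code_def
    by (intro sigma1_intros ce1_app[OF ce1_theory[OF assms]] ce1_app[OF ce1_is_fm] ce1_app[OF ce1_is_trm]
        ce2_app[OF ce2_lift_code] ce3_app[OF ce3_inst_code])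
  moreover have "ce3 rule_code"
    unfolding ce3_def rule_code_def by (intro sigma1_intros)
  moreover have "prov_code U = ind_set (axiom_code U) rule_code" by (rule ext) (rule prov_code_iff)
  ultimately show ?thesis using ce1_ind_set by simp
qed

section \<open>Applying formulas to argument lists\<close>

text \<open>Missing arguments become \<open>Zr\<close>, and 0 in \<open>env\<close>. Hence
  \<open>ap A ts\<close> has no free variables beyond those of \<open>ts\<close>, even when
  \<open>A\<close> comes from a definability lemma that does not limit its variables.\<close>

definition args :: "trm list \<Rightarrow> nat \<Rightarrow> trm" where
  "args ts i = (if i < length ts then ts ! i else Zr)"

definition env :: "nat list \<Rightarrow> nat \<Rightarrow> nat" where
  "env xs i = (if i < length xs then xs ! i else 0)"

abbreviation ap :: "fm \<Rightarrow> trm list \<Rightarrow> fm" where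
  "ap A ts \<equiv> psubF (args ts) A"

lemma args_simps [simp]:
  "args (t # ts) 0 = t" "args (t # ts) (Suc i) = args ts i" "args [] i = Zr"
  by (simp_all add: args_def)

lemma psubT_args: "psubT \<sigma> (args ts i) = args (map (psubT \<sigma>) ts) i"
  by (simp add: args_def)

text \<open>Substitution acts on the arguments and leaves \<open>A\<close> folded. Calculations that
  must keep the \<open>ap\<close> form use this rule in place of \<open>psubF_psubF\<close>, which
  would merge the two substitutions.\<close>

lemma psubF_ap: "psubF \<sigma> (ap A ts) = ap A (map (psubT \<sigma>) ts)"
  by (simp add: psubT_args)

lemma evalF_ap: "evalF e (ap A ts) = evalF (env (map (evalT e) ts)) A"
proof -
  have "(\<lambda>i. evalT e (args ts i)) = env (map (evalT e) ts)"
    by (auto simp: args_def env_def)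
  then show ?thesis by (simp add: evalF_psubF)
qed

lemma ap_num: "ap A (map num xs) = psubF (\<lambda>i. num (env xs i)) A"
proof -
  have "args (map num xs) = (\<lambda>i. num (env xs i))" by (auto simp: args_def env_def)
  then show ?thesis by simp
qed

lemma closedF_psubF_all: "(\<And>i. closedT m (\<sigma> i)) \<Longrightarrow> closedF m (psubF \<sigma> A)"
proof (induction A arbitrary: m \<sigma>)
  case (Forall A)
  have "closedF (Suc m) (psubF (up \<sigma>) A)"
    by (rule Forall.IH) (use Forall.prems in \<open>auto simp: up_def closedT_liftT split: nat.splits\<close>)
  then show ?case by simp
next
  case (Eqt t s)
  have "closedT m (psubT \<sigma> t)" for t using Eqt by (induction t) auto
  then show ?case by simp
next
  case (Leq t s)
  have "closedT m (psubT \<sigma> t)" for t using Leq by (induction t) auto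
  then show ?case by simp
qed auto

lemma closedF_ap: "(\<forall>t \<in> set ts. closedT m t) \<Longrightarrow> closedF m (ap A ts)"
  by (rule closedF_psubF_all) (auto simp: args_def)

lemma EA_Delta0_true: "Delta0 A \<Longrightarrow> evalF (env xs) A \<Longrightarrow> proves EA (ap A (map num xs))"
  using EA_Delta0_decides[of A "env xs"] by (simp add: ap_num)

lemma EA_Delta0_false: "Delta0 A \<Longrightarrow> \<not> evalF (env xs) A \<Longrightarrow> proves EA (Neg (ap A (map num xs)))"
  using EA_Delta0_decides[of A "env xs"] by (simp add: ap_num)

section \<open>Deduction theorem and monotonicity of quantifiers\<close>

lemma deduction_theorem:
  assumes "proves (insert A T) B" and "sentence A"
  shows "proves T (Imp A B)"
  using assms(1)
proof (induction "insert A T" B rule: proves.induct)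
  case (hyp B)
  show ?case
  proof (cases "B = A")
    case True
    then show ?thesis by (intro taut0) simp
  next
    case False
    then have "proves T B" using hyp by (auto intro: proves.hyp)
    then show ?thesis by (rule taut1) simp
  qed
next
  case (mp B C)
  show ?case by (rule taut2[OF mp(2) mp(4)]) simp
next
  case (gen B)
  \<comment> \<open>A sentence is unchanged by lifting, so generalisation passes under the
    implication.\<close>
  have "liftF 0 A = A" using assms(2) by (simp add: liftF_0 psubF_sentence)
  then show ?case using ForallI[of T A B] gen(2) by simp
next
  case (axInst B t)
  show ?case by (rule taut1[OF proves.axInst[of _ B t]]) simp
next
  case (axAllImp B C)
  show ?case by (rule taut1[OF proves.axAllImp[of _ B C]]) simp
next
  case (axRefl t)
  show ?case by (rule taut1[OF proves.axRefl[of _ t]]) simp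
next
  case (axLeib t s B)
  show ?case by (rule taut1[OF proves.axLeib[of _ t s B]]) simp
qed (rule taut0, simp)+

text \<open>The side condition \<open>H\<close>, for instance a lower bound on the stage, is lifted
  so that it remains available under the quantifier.\<close>

lemma BAll_mono:
  assumes "proves T (Imp (liftF 0 H) (Imp A B))"
  shows "proves T (Imp H (Imp (BAll t A) (BAll t B)))"
proof -
  have "liftF 0 (BAll t A) = BAll (liftT 0 t) (psubF (up (\<lambda>i. Var (Suc i))) A)"
    by (simp add: liftF_0 liftT_0)
  moreover have "(\<lambda>i. psubT (case_nat (Var 0) Var) (up (\<lambda>i. Var (Suc i)) i)) = Var"
    by (auto simp: up_def split: nat.splits)
  ultimately have 1: "proves T (Imp (liftF 0 (BAll t A)) (Imp (Leq (Var 0) (liftT 0 t)) A))"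
    using BAllE[of T "liftT 0 t" "psubF (up (\<lambda>i. Var (Suc i))) A" "Var 0"] by simp
  have "proves T (Imp (liftF 0 (Conj H (BAll t A))) (Imp (Leq (Var 0) (liftT 0 t)) B))"
    by (rule taut2[OF assms 1]) (simp add: Conj_def)
  then show ?thesis by (rule taut1[OF BAllI]) simp
qed

lemma BAll_cong: "proves T (Iff A B) \<Longrightarrow> proves T (Iff (BAll t A) (BAll t B))"
proof -
  assume *: "proves T (Iff A B)"
  \<comment> \<open>The tautology \<open>Imp Fls Fls\<close> serves as an empty side
    condition.\<close>
  have "proves T (Imp (Imp Fls Fls) (Imp (BAll t A) (BAll t B)))"
    by (rule BAll_mono) (rule taut1[OF *], simp)
  moreover have "proves T (Imp (Imp Fls Fls) (Imp (BAll t B) (BAll t A)))"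
    by (rule BAll_mono) (rule taut1[OF *], simp)
  ultimately show ?thesis by (rule taut2) auto
qed

lemma BEx_cong: "proves T (Iff A B) \<Longrightarrow> proves T (Iff (BEx t A) (BEx t B))"
proof -
  assume "proves T (Iff A B)"
  then have "proves T (Iff (Neg A) (Neg B))" by (rule taut1) simp
  then have "proves T (Iff (BAll t (Neg A)) (BAll t (Neg B)))" by (rule BAll_cong)
  then show ?thesis by (rule taut1) (simp add: holds_BEx)
qed

lemma Forall_mono: "proves T (Imp A B) \<Longrightarrow> proves T (Imp (Forall A) (Forall B))"
proof -
  assume *: "proves T (Imp A B)"
  have "(\<lambda>i. psubT (case_nat (Var 0) Var) (up (\<lambda>i. Var (Suc i)) i)) = Var"
    by (auto simp: up_def split: nat.splits)
  moreover have "liftF 0 (Forall A) = Forall (psubF (up (\<lambda>i. Var (Suc i))) A)"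
    by (simp only: liftF_0 psubF.simps)
  ultimately have "proves T (Imp (liftF 0 (Forall A)) A)"
    using axInst[of T "psubF (up (\<lambda>i. Var (Suc i))) A" "Var 0"] by (simp add: inst_eq_psubF)
  then have "proves T (Imp (liftF 0 (Forall A)) B)" by (rule taut2[OF _ *]) simp
  then show ?thesis by (rule ForallI)
qed

text \<open>Splits the stage at a standard number: below it Delta0 computation settles the matter,
  above it an argument uniform in the stage.\<close>

lemma EA_by_cases_num:
  assumes "proves EA (BAll (num n) A)" and "proves EA (Imp (Leq (num n) (Var 0)) A)"
  shows "proves EA A"
proof -
  have "proves EA (Forall (Imp (Leq (Var 0) (num n)) A))" using assms(1) by (simp add: BAll_def)
  then have "proves EA (Imp (Leq (Var 0) (num n)) A)" by (rule proves_ForallD[OF EA_sentences])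
  then show ?thesis by (rule taut3[OF _ assms(2) EA_Leq_total[of n]]) auto
qed

section \<open>The stage formulas\<close>

text \<open>
  Free variables: in \<open>ClosedF\<close>, 0 is the coded set \<open>b\<close> and 1 the stage \<open>s\<close>; in \<open>StageF\<close> and
  \<open>MatrixF\<close>, 0 is the stage, 1 the code of the self-applied formula and 2 the code \<open>x\<close>. The formula
  \<open>M\<close> takes an element and a set, \<open>E\<close> a witness and two codes, \<open>F\<close> a witness, the code of the
  self-applied formula and a code.
\<close>

definition ClosedF :: "fm \<Rightarrow> fm \<Rightarrow> fm" where
  "ClosedF E M = BAll (Var 1) (BAll (Var 2) (BAll (Var 3) (Imp (ap E [Var 0, Var 2, Var 1])
     (Imp (ap M [Var 2, Var 3]) (ap M [Var 1, Var 3])))))"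

text \<open>Every subset of {0..s} has a code below 2^(s+1), so all closed sets at stage s are
  covered. Asking each closed set around x for a suitable element amounts to asking the least one,
  the class of x. Innermost, the indices are: witness 0, element 1, set 2, stage 3, self-applied
  code 4.\<close>

definition StageF :: "fm \<Rightarrow> fm \<Rightarrow> fm \<Rightarrow> fm" where
  "StageF E M F = Conj (Leq (Var 2) (Var 0)) (BAll (Ex2 (Sc (Var 0))) (Imp (ClosedF E M) (Imp (ap M [Var 3, Var 0])
     (BEx (Var 1) (Conj (ap M [Var 0, Var 1]) (BEx (Var 2) (ap F [Var 0, Var 4, Var 1])))))))"

text \<open>The negative stage may equal the positive one, so a tie counts for
  \<open>\<rho>\<close>. Hence \<open>EA_app_code\<close> excludes positive stages below
  \<open>s\<close>, while \<open>EA_not_app_code\<close> excludes negative stages up to and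
  including \<open>s\<close>.\<close>

definition MatrixF :: "fm \<Rightarrow> fm \<Rightarrow> fm \<Rightarrow> fm \<Rightarrow> fm" where
  "MatrixF E M P N = Imp (StageF E M P) (BEx (Var 0) (ap (StageF E M N) [Var 0, Var 2, Var 3]))"

lemma Delta0_StageF: "Delta0 E \<Longrightarrow> Delta0 M \<Longrightarrow> Delta0 F \<Longrightarrow> Delta0 (StageF E M F)"
  unfolding StageF_def ClosedF_def
  by (intro Delta0_Conj Delta0_BAll Delta0_BEx Delta0_psubF Delta0.intros) auto

lemma Delta0_MatrixF: "Delta0 E \<Longrightarrow> Delta0 M \<Longrightarrow> Delta0 P \<Longrightarrow> Delta0 N \<Longrightarrow> Delta0 (MatrixF E M P N)"
  unfolding MatrixF_def
  by (intro Delta0_BEx Delta0_psubF Delta0.intros(4) Delta0_StageF)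

lemma closedF_StageF: "closedF 3 (StageF E M F)"
  unfolding StageF_def ClosedF_def by (simp add: closedF_ap)

lemma closedF_MatrixF: "closedF 3 (MatrixF E M P N)"
  unfolding MatrixF_def using closedF_StageF by (simp add: closedF_ap)

definition stage :: "(nat \<Rightarrow> nat \<Rightarrow> nat \<Rightarrow> bool) \<Rightarrow> (nat \<Rightarrow> nat \<Rightarrow> bool) \<Rightarrow> nat \<Rightarrow> nat \<Rightarrow> bool" where
  "stage Er Fr s x \<longleftrightarrow> x \<le> s \<and> (\<forall>b \<le> (2::nat) ^ Suc s. (\<forall>u \<le> s. \<forall>v \<le> s. \<forall>w \<le> s. Er w u v \<longrightarrow> bit b u \<longrightarrow> bit b v)
     \<longrightarrow> bit b x \<longrightarrow> (\<exists>c \<le> s. bit b c \<and> (\<exists>w \<le> s. Fr w c)))"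

lemma evalF_StageF:
  assumes "\<And>e. evalF e M = bit (e 1) (e 0)"
  shows "evalF (env [s, k, x]) (StageF E M F) =
    stage (\<lambda>w u v. evalF (env [w, u, v]) E) (\<lambda>w c. evalF (env [w, k, c]) F) s x"
  unfolding StageF_def ClosedF_def stage_def
  by (simp add: evalF_ap assms) (simp add: env_def numeral_eq_Suc)

lemma evalF_MatrixF: "evalF (env [s, k, x]) (MatrixF E M P N) \<longleftrightarrow>
    (evalF (env [s, k, x]) (StageF E M P) \<longrightarrow> (\<exists>t \<le> s. evalF (env [t, k, x]) (StageF E M N)))"
  unfolding MatrixF_def by (simp add: evalF_ap) (simp add: env_def numeral_eq_Suc)

text \<open>The three quantifiers are instantiated at \<open>g\<close>, \<open>f\<close> and
  \<open>w\<close>, which are at most \<open>n\<close> and hence at most the stage; the instance of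
  \<open>E\<close> is then a true Delta0 statement, which EA proves.\<close>

lemma EA_ClosedF:
  assumes "Delta0 E" "evalF (env [w, g, f]) E" "w \<le> n" "g \<le> n" "f \<le> n"
  shows "proves EA (Imp (Leq (num n) (Var 1)) (Imp (ClosedF E M) (Imp (ap M [num g, Var 0]) (ap M [num f, Var 0]))))"
proof -
  let ?C1 = "BAll (Var 1) (BAll (Var 2) (Imp (ap E [Var 0, num g, Var 1])
     (Imp (ap M [num g, Var 2]) (ap M [Var 1, Var 2]))))"
  let ?C2 = "BAll (Var 1) (Imp (ap E [Var 0, num g, num f])
     (Imp (ap M [num g, Var 1]) (ap M [num f, Var 1])))"
  have "proves EA (Imp (ClosedF E M) (Imp (Leq (num g) (Var 1)) ?C1))"
    using BAllE[of EA "Var 1" "BAll (Var 2) (BAll (Var 3) (Imp (ap E [Var 0, Var 2, Var 1])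
     (Imp (ap M [Var 2, Var 3]) (ap M [Var 1, Var 3]))))" "num g"]
    by (simp add: ClosedF_def psubF_ap numeral_eq_Suc del: psubF_psubF)
  then have 1: "proves EA (Imp (Leq (num n) (Var 1)) (Imp (ClosedF E M) ?C1))"
    by (rule taut2[OF _ EA_Leq_num_mono[OF assms(4), of "Var 1"]]) simp
  have "proves EA (Imp ?C1 (Imp (Leq (num f) (Var 1)) ?C2))"
    using BAllE[of EA "Var 1" "BAll (Var 2) (Imp (ap E [Var 0, num g, Var 1])
     (Imp (ap M [num g, Var 2]) (ap M [Var 1, Var 2])))" "num f"]
    by (simp add: psubF_ap numeral_eq_Suc del: psubF_psubF)
  then have 2: "proves EA (Imp (Leq (num n) (Var 1)) (Imp ?C1 ?C2))"
    by (rule taut2[OF _ EA_Leq_num_mono[OF assms(5), of "Var 1"]]) simp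
  have "proves EA (Imp ?C2 (Imp (Leq (num w) (Var 1)) (Imp (ap E [num w, num g, num f])
     (Imp (ap M [num g, Var 0]) (ap M [num f, Var 0])))))"
    using BAllE[of EA "Var 1" "Imp (ap E [Var 0, num g, num f])
     (Imp (ap M [num g, Var 1]) (ap M [num f, Var 1]))" "num w"]
    by (simp add: psubF_ap numeral_eq_Suc del: psubF_psubF)
  then have 3: "proves EA (Imp (Leq (num n) (Var 1)) (Imp ?C2 (Imp (ap M [num g, Var 0]) (ap M [num f, Var 0]))))"
    by (rule taut3[OF _ EA_Leq_num_mono[OF assms(3), of "Var 1"] EA_Delta0_true[OF assms(1,2)]]) simp
  show ?thesis by (rule taut3[OF 1 2 3]) simp
qed

text \<open>From stage \<open>n\<close> on, a closed set containing \<open>g\<close> contains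
  \<open>f\<close>, and the conclusion \<open>G\<close> about the set does not mention the code. So
  what holds of all closed sets around \<open>f\<close> holds of those around
  \<open>g\<close>.\<close>

lemma EA_StageF_transfer:
  assumes "Delta0 E" "evalF (env [w, g, f]) E" "w \<le> n" "g \<le> n" "f \<le> n"
  shows "proves EA (Imp (Leq (num n) (Var 0)) (Imp (ap (StageF E M F) [Var 0, num k, num f])
      (ap (StageF E M F) [Var 0, num k, num g])))"
proof -
  define G where "G = BEx (Var 1) (Conj (ap M [Var 0, Var 1]) (BEx (Var 2) (ap F [Var 0, num k, Var 1])))"
  have S: "ap (StageF E M F) [Var 0, num k, num x] = Conj (Leq (num x) (Var 0))
      (BAll (Ex2 (Sc (Var 0))) (Imp (ClosedF E M) (Imp (ap M [num x, Var 0]) G)))" for x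
    unfolding StageF_def ClosedF_def G_def
    by (simp add: psubF_ap numeral_eq_Suc del: psubF_psubF)
  have "proves EA (Imp (Leq (num n) (Var 1)) (Imp (Imp (ClosedF E M) (Imp (ap M [num f, Var 0]) G))
     (Imp (ClosedF E M) (Imp (ap M [num g, Var 0]) G))))"
    by (rule taut1[OF EA_ClosedF[OF assms, of M]]) simp
  then have "proves EA (Imp (liftF 0 (Leq (num n) (Var 0))) (Imp (Imp (ClosedF E M) (Imp (ap M [num f, Var 0]) G))
     (Imp (ClosedF E M) (Imp (ap M [num g, Var 0]) G))))" by simp
  from BAll_mono[OF this, of "Ex2 (Sc (Var 0))"]
  show ?thesis unfolding S
    by (rule taut2[OF _ EA_Leq_num_mono[OF assms(4), of "Var 0"]]) simp
qed

section \<open>The extensional Rosser formula\<close>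

text \<open>The code of \<open>Iff\<close>, unfolded to implication (tag 3) and falsity (tag
  0).\<close>

definition equiv_code :: "fm set \<Rightarrow> nat \<Rightarrow> nat \<Rightarrow> bool" where
  "equiv_code U a b \<longleftrightarrow> prov_code U (imp_code (imp_code (imp_code a b)
     (imp_code (imp_code b a) (prod_encode (0, 0)))) (prod_encode (0, 0)))"

text \<open>Diagonalisation: the formula coded by \<open>k\<close> is applied to its own numeral and
  then to the numeral of \<open>c\<close>. For the code of \<open>\<theta>\<close> this gives the
  code of \<open>\<rho>\<close> at \<open>c\<close>.\<close>

definition self_app_code :: "nat \<Rightarrow> nat \<Rightarrow> nat \<Rightarrow> bool" where
  "self_app_code k c r \<longleftrightarrow> (\<exists>n m q. num_code k n \<and> num_code c m \<and> inst_code k n q \<and> inst_code q m r)"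

definition asserts_code :: "fm set \<Rightarrow> nat \<Rightarrow> nat \<Rightarrow> bool" where
  "asserts_code U k c \<longleftrightarrow> (\<exists>r. self_app_code k c r \<and> prov_code U (imp_code c r))"

definition denies_code :: "fm set \<Rightarrow> nat \<Rightarrow> nat \<Rightarrow> bool" where
  "denies_code U k c \<longleftrightarrow> (\<exists>r. self_app_code k c r \<and> prov_code U (imp_code c (imp_code r (prod_encode (0, 0)))))"

lemma prov_code_codeF [simp]: "prov_code U (codeF A) \<longleftrightarrow> proves U A"
  unfolding prov_code_def by (auto simp: codeF_inj)

lemma equiv_code_iff: "equiv_code U (codeF A) (codeF B) \<longleftrightarrow> proves U (Iff A B)"
  unfolding equiv_code_def prov_code_codeF[symmetric] by (simp add: Iff_def Conj_def Neg_def)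

text \<open>The numbers \<open>a\<close> and \<open>b\<close> are arbitrary; inverting the code of
  the provable formula three layers deep shows that they code formulas.\<close>

lemma equiv_codeD: "equiv_code U a b \<Longrightarrow> \<exists>A B. a = codeF A \<and> b = codeF B \<and> proves U (Iff A B)"
proof -
  assume *: "equiv_code U a b"
  then obtain C where C: "codeF C = imp_code (imp_code (imp_code a b)
     (imp_code (imp_code b a) (prod_encode (0, 0)))) (prod_encode (0, 0))"
    unfolding equiv_code_def prov_code_def by auto
  obtain D D' where D: "codeF D = imp_code (imp_code a b) D'" using C by (cases C) auto
  obtain F where F: "codeF F = imp_code a b" using D by (cases D) auto
  obtain A B where "a = codeF A" "b = codeF B" using F by (cases F) auto
  then show ?thesis using * equiv_code_iff by blast
qed

lemma self_app_code_iff: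
  "self_app_code (codeF A) (codeF B) r \<longleftrightarrow> r = codeF (inst (inst A (num (codeF A))) (num (codeF B)))"
  unfolding self_app_code_def num_code_def inst_code_def by (auto simp: codeF_inj codeT_inj)

lemma asserts_code_iff:
  "asserts_code U (codeF A) (codeF B) \<longleftrightarrow> proves U (Imp B (inst (inst A (num (codeF A))) (num (codeF B))))"
  unfolding asserts_code_def self_app_code_iff prov_code_codeF[symmetric] by simp

lemma denies_code_iff:
  "denies_code U (codeF A) (codeF B) \<longleftrightarrow> proves U (Imp B (Neg (inst (inst A (num (codeF A))) (num (codeF B)))))"
  unfolding denies_code_def self_app_code_iff prov_code_codeF[symmetric] by (simp add: Neg_def)

lemma ce2_equiv_code:
  assumes "ce_theory U"
  shows "ce2 (equiv_code U)"
  unfolding ce2_def equiv_code_def by (intro sigma1_intros ce1_app[OF ce1_prov_code[OF assms]])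

lemma ce3_self_app_code: "ce3 self_app_code"
  unfolding ce3_def self_app_code_def
  by (intro sigma1_intros ce2_app[OF ce2_num_code] ce3_app[OF ce3_inst_code])

lemma ce2_asserts_code:
  assumes "ce_theory U"
  shows "ce2 (asserts_code U)"
  unfolding ce2_def asserts_code_def
  by (intro sigma1_intros ce1_app[OF ce1_prov_code[OF assms]] ce3_app[OF ce3_self_app_code])

lemma ce2_denies_code:
  assumes "ce_theory U"
  shows "ce2 (denies_code U)"
  unfolding ce2_def denies_code_def
  by (intro sigma1_intros ce1_app[OF ce1_prov_code[OF assms]] ce3_app[OF ce3_self_app_code])

lemma ce2_formula:
  assumes "ce2 R"
  obtains A where "Delta0 A" "\<And>x y. (\<exists>w. evalF (env [w, x, y]) A) \<longleftrightarrow> R x y"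
proof -
  obtain Q where Q: "delta0_pred Q" "\<And>e. R (e 0) (e 1) \<longleftrightarrow> (\<exists>w. Q (case_nat w e))"
    using assms unfolding ce2_def sigma1_pred_def by blast
  obtain A where A: "Delta0 A" "\<And>e. evalF e A = Q e"
    using Q(1) unfolding delta0_pred_def by blast
  have "case_nat w (env [x, y]) = env [w, x, y]" for w x y
    by (auto simp: env_def split: nat.splits)
  then have "(\<exists>w. evalF (env [w, x, y]) A) \<longleftrightarrow> R x y" for x y
    using Q(2)[of "env [x, y]"] unfolding A(2) by (simp add: env_def[of "[x, y]"])
  with A(1) show ?thesis by (rule that)
qed

locale extensional_rosser =
  fixes U :: "fm set" and E M P N :: fm
  assumes EA_sub: "extends_EA U"
    and Delta0: "Delta0 E" "Delta0 M" "Delta0 P" "Delta0 N"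
    and M_iff: "\<And>e. evalF e M = bit (e 1) (e 0)"
    and E_iff: "\<And>a b. (\<exists>w. evalF (env [w, a, b]) E) \<longleftrightarrow> equiv_code U a b"
    and P_iff: "\<And>k c. (\<exists>w. evalF (env [w, k, c]) P) \<longleftrightarrow> asserts_code U k c"
    and N_iff: "\<And>k c. (\<exists>w. evalF (env [w, k, c]) N) \<longleftrightarrow> denies_code U k c"
begin

definition \<theta> :: fm where "\<theta> = Forall (MatrixF E M P N)"
text \<open>In \<open>\<theta>\<close> variable 0 stands for a formula code and variable 1 for x.
  Putting its own code for the former makes the stage relations speak of \<open>\<rho>\<close>
  itself, by \<open>self_app_code_iff\<close>.\<close>

definition \<rho> :: fm where "\<rho> = inst \<theta> (num (codeF \<theta>))"

abbreviation "k \<equiv> codeF \<theta>"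

abbreviation pos_stage :: "nat \<Rightarrow> nat \<Rightarrow> bool" where
  "pos_stage s x \<equiv> evalF (env [s, k, x]) (StageF E M P)"

abbreviation neg_stage :: "nat \<Rightarrow> nat \<Rightarrow> bool" where
  "neg_stage s x \<equiv> evalF (env [s, k, x]) (StageF E M N)"

lemma Pi1_\<rho>: "Pi1 \<rho>"
  unfolding \<rho>_def \<theta>_def inst_eq_psubF psubF.simps
  by (intro Pi1.intros Delta0_psubF Delta0_MatrixF Delta0)

lemma closedF_\<rho>: "closedF 1 \<rho>"
proof -
  have "closedF 2 \<theta>" unfolding \<theta>_def using closedF_MatrixF by (simp add: numeral_eq_Suc)
  then show ?thesis unfolding \<rho>_def inst_eq_psubF
    by (rule closedF_psubF) (auto split: nat.splits)
qed

lemma app_code_\<rho>: "app_code \<rho> A = Forall (ap (MatrixF E M P N) [Var 0, num k, num (codeF A)])"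
proof -
  have "ap (MatrixF E M P N) [Var 0, num k, num (codeF A)] = psubF (\<lambda>i. psubT (up (case_nat (num (codeF A)) Var)) (up (case_nat (num k) Var) i)) (MatrixF E M P N)"
  proof (rule psubF_cong_closed[OF closedF_MatrixF])
    fix i :: nat assume "i < 3"
    then have "i = 0 \<or> i = 1 \<or> i = 2" by auto
    then show "args [Var 0, num k, num (codeF A)] i = psubT (up (case_nat (num (codeF A)) Var)) (up (case_nat (num k) Var) i)"
      by (auto simp: args_def numeral_eq_Suc)
  qed
  then show ?thesis
    unfolding app_code_def \<rho>_def inst_eq_psubF \<theta>_def by simp
qed

lemma sentence_app_code: "sentence (app_code \<rho> A)"
  unfolding sentence_def app_code_\<rho> by (simp add: closedF_ap)

lemma U_proves_EA: "proves EA A \<Longrightarrow> proves U A"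
  by (rule proves_cut) (use EA_sub in \<open>simp_all add: extends_EA_def\<close>)

section \<open>Stages in the standard model and the decisions of EA\<close>

lemma pos_witness: "(\<exists>w. evalF (env [w, k, codeF A]) P) \<longleftrightarrow> proves U (Imp A (app_code \<rho> A))"
  unfolding P_iff asserts_code_iff app_code_def \<rho>_def ..

lemma neg_witness: "(\<exists>w. evalF (env [w, k, codeF A]) N) \<longleftrightarrow> proves U (Imp A (Neg (app_code \<rho> A)))"
  unfolding N_iff denies_code_iff app_code_def \<rho>_def ..

text \<open>The quantifier over closed sets is instantiated at the true \<open>U\<close>-class of
  \<open>A\<close>, cut off at \<open>s\<close>. It is closed because every witness for
  \<open>E\<close> comes with a \<open>U\<close>-proof of the equivalence.\<close>

lemma stage_class:
  assumes "evalF (env [s, k, codeF A]) (StageF E M F)"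
  obtains C w where "proves U (Iff A C)" "codeF C \<le> s" "w \<le> s" "evalF (env [w, k, codeF C]) F"
proof -
  have st: "stage (\<lambda>w u v. evalF (env [w, u, v]) E) (\<lambda>w c. evalF (env [w, k, c]) F) s (codeF A)"
    using assms by (simp add: evalF_StageF[OF M_iff])
  let ?X = "{c. c \<le> s \<and> (\<exists>C. c = codeF C \<and> proves U (Iff A C))}"
  have "finite ?X" by (rule finite_subset[of _ "{..s}"]) auto
  then obtain b :: nat where b: "\<forall>p. bit b p \<longleftrightarrow> p \<in> ?X" using finite_set_bits by blast
  \<comment> \<open>No element exceeds \<open>s\<close>, so the code lies in the range of the set
    quantifier.\<close>
  have le: "b \<le> 2 ^ Suc s"
  proof -
    have "take_bit (Suc s) b = b"
      by (rule bit_eqI) (use b in \<open>auto simp: bit_take_bit_iff\<close>)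
    then have "b < 2 ^ Suc s" by (metis take_bit_nat_less_exp)
    then show ?thesis by simp
  qed
  have closed: "\<forall>u \<le> s. \<forall>v \<le> s. \<forall>w \<le> s. evalF (env [w, u, v]) E \<longrightarrow> bit b u \<longrightarrow> bit b v"
  proof (intro allI impI)
    fix u v w assume "v \<le> s" "evalF (env [w, u, v]) E" "bit b u"
    then have "equiv_code U u v" using E_iff by blast
    then obtain B C where BC: "u = codeF B" "v = codeF C" "proves U (Iff B C)" using equiv_codeD by blast
    have "proves U (Iff A B)" using \<open>bit b u\<close> b BC(1) by (auto simp: codeF_inj)
    then have "proves U (Iff A C)" by (rule taut2[OF _ BC(3)]) simp
    then show "bit b v" using b BC(2) \<open>v \<le> s\<close> by auto
  qed
  have mem: "bit b (codeF A)"
  proof -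
    have "proves U (Iff A A)" by (rule taut0) simp
    then show ?thesis using b st unfolding stage_def by auto
  qed
  obtain c w where c: "bit b c" "w \<le> s" "evalF (env [w, k, c]) F"
    using st[unfolded stage_def, THEN conjunct2, THEN spec, THEN HOL.mp, OF le, THEN HOL.mp, OF closed, THEN HOL.mp, OF mem]
    by blast
  then obtain C where "c = codeF C" "codeF C \<le> s" "proves U (Iff A C)" using b by auto
  then show ?thesis using that[of C w] c by simp
qed

text \<open>Every set containing \<open>c\<close> offers \<open>c\<close> itself as the required
  element.\<close>

lemma stage_self:
  assumes "c \<le> s" "w \<le> s" "evalF (env [w, k, c]) F"
  shows "evalF (env [s, k, c]) (StageF E M F)"
  unfolding evalF_StageF[OF M_iff] stage_def
proof (intro conjI allI impI)
  fix b :: nat assume "bit b c"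
  then show "\<exists>c \<le> s. bit b c \<and> (\<exists>w \<le> s. evalF (env [w, k, c]) F)"
    using assms by (intro exI[of _ c] exI[of _ w] conjI)
qed (rule assms(1))

text \<open>Up to stage \<open>s\<close> the matrix is a true Delta0 statement, since only
  \<open>s\<close> itself can be positive there and it is also negative. Beyond \<open>s\<close>,
  stage \<open>s\<close> is the negative stage that the matrix demands.\<close>

lemma EA_app_code:
  assumes "\<forall>t < s. \<not> pos_stage t (codeF A)" "neg_stage s (codeF A)"
  shows "proves EA (app_code \<rho> A)"
proof -
  let ?c = "codeF A"
  let ?m = "ap (MatrixF E M P N) [Var 0, num k, num ?c]"
  have "proves EA ?m"
  proof (rule EA_by_cases_num)
    let ?B = "BAll (Var 0) (ap (MatrixF E M P N) [Var 0, Var 2, Var 3])"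
    have "evalF (env [s, k, ?c]) ?B"
    proof -
      have "evalF (env [t, k, ?c]) (MatrixF E M P N)" if "t \<le> s" for t
        unfolding evalF_MatrixF using assms that by (cases "t = s") auto
      then show ?thesis by (simp add: evalF_ap) (simp add: env_def numeral_eq_Suc)
    qed
    then have "proves EA (ap ?B (map num [s, k, ?c]))"
      by (intro EA_Delta0_true Delta0_BAll Delta0_psubF Delta0_MatrixF Delta0)
    moreover have "ap ?B (map num [s, k, ?c]) = BAll (num s) ?m"
      by (simp add: psubF_ap numeral_eq_Suc del: psubF_psubF)
    ultimately show "proves EA (BAll (num s) ?m)" by simp
    have m: "?m = Imp (ap (StageF E M P) [Var 0, num k, num ?c]) (BEx (Var 0) (ap (StageF E M N) [Var 0, num k, num ?c]))"
      unfolding MatrixF_def by (simp add: psubF_ap numeral_eq_Suc del: psubF_psubF)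
    have "proves EA (Imp (Leq (num s) (Var 0)) (Imp (ap (StageF E M N) [num s, num k, num ?c])
        (BEx (Var 0) (ap (StageF E M N) [Var 0, num k, num ?c]))))"
      using BExI[of EA "num s" "Var 0" "ap (StageF E M N) [Var 0, num k, num ?c]"]
      by (simp add: psubF_ap del: psubF_psubF)
    moreover have "proves EA (ap (StageF E M N) [num s, num k, num ?c])"
      using EA_Delta0_true[of "StageF E M N" "[s, k, ?c]"] assms(2) Delta0_StageF Delta0 by simp
    ultimately show "proves EA (Imp (Leq (num s) (Var 0)) ?m)"
      unfolding m by (rule taut2) simp
  qed
  then show ?thesis unfolding app_code_\<rho> by (rule proves.gen)
qed

text \<open>The matrix at stage \<open>s\<close> is a false Delta0 statement, refuted by EA.\<close>

lemma EA_not_app_code: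
  assumes "\<forall>t \<le> s. \<not> neg_stage t (codeF A)" "pos_stage s (codeF A)"
  shows "proves EA (Neg (app_code \<rho> A))"
proof -
  let ?m = "MatrixF E M P N" and ?c = "codeF A"
  have "\<not> evalF (env [s, k, ?c]) ?m" unfolding evalF_MatrixF using assms by blast
  then have "proves EA (Neg (ap ?m (map num [s, k, ?c])))"
    by (intro EA_Delta0_false Delta0_MatrixF Delta0)
  then have 1: "proves EA (Neg (ap ?m [num s, num k, num ?c]))" by simp
  have "proves EA (Imp (app_code \<rho> A) (ap ?m [num s, num k, num ?c]))"
    using axInst[of EA "ap ?m [Var 0, num k, num ?c]" "num s"] unfolding app_code_\<rho> inst_eq_psubF
    by (simp add: psubF_ap del: psubF_psubF)
  then show ?thesis by (rule taut2[OF _ 1]) simp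
qed

text \<open>The formula is arbitrary in the induction: a stage \<open>s\<close> of \<open>A\<close>
  is passed to an equivalent \<open>C\<close>, and the induction hypothesis then excludes the
  earlier stages of \<open>C\<close>.\<close>

lemma no_stage:
  assumes "\<not> proves U (Neg A)"
  shows "\<not> pos_stage s (codeF A) \<and> \<not> neg_stage s (codeF A)"
  using assms
proof (induction s arbitrary: A rule: less_induct)
  case (less s)
  have equiv: "\<not> proves U (Neg C)" if "\<not> proves U (Neg A)" "proves U (Iff A C)" for A C
    using taut2[OF that(2), of "Neg C" "Neg A"] that(1) by auto
  \<comment> \<open>Proved first and for every formula, because the positive case must also exclude
    a negative stage at \<open>s\<close> itself.\<close>
  have neg: "\<not> neg_stage s (codeF A)" if A: "\<not> proves U (Neg A)" for A
  proof
    assume "neg_stage s (codeF A)"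
    then obtain C w where C: "proves U (Iff A C)" "codeF C \<le> s" "w \<le> s" "evalF (env [w, k, codeF C]) N"
      by (rule stage_class)
    have "neg_stage s (codeF C)" using C(2-4) by (rule stage_self)
    moreover have "\<forall>t < s. \<not> pos_stage t (codeF C)" using less.IH equiv[OF A C(1)] by blast
    ultimately have "proves U (app_code \<rho> C)" using EA_app_code U_proves_EA by blast
    moreover have "proves U (Imp C (Neg (app_code \<rho> C)))" using C(4) neg_witness by blast
    ultimately have "proves U (Neg C)" by (rule taut2) auto
    then show False using equiv[OF A C(1)] by blast
  qed
  moreover have "\<not> pos_stage s (codeF A)"
  proof
    assume "pos_stage s (codeF A)"
    then obtain C w where C: "proves U (Iff A C)" "codeF C \<le> s" "w \<le> s" "evalF (env [w, k, codeF C]) P"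
      by (rule stage_class)
    have good: "\<not> proves U (Neg C)" by (rule equiv[OF less.prems C(1)])
    have "pos_stage s (codeF C)" using C(2-4) by (rule stage_self)
    moreover have "\<forall>t \<le> s. \<not> neg_stage t (codeF C)"
      using less.IH[of _ C] neg[OF good] good by (metis le_neq_implies_less)
    ultimately have "proves U (Neg (app_code \<rho> C))" using EA_not_app_code U_proves_EA by blast
    moreover have "proves U (Imp C (app_code \<rho> C))" using C(4) pos_witness by blast
    ultimately have "proves U (Neg C)" by (rule taut2) auto
    then show False using good by blast
  qed
  ultimately show ?case using less.prems by blast
qed

lemma not_asserts:
  assumes "\<not> proves U (Neg A)"
  shows "\<not> proves U (Imp A (app_code \<rho> A))" and "\<not> proves U (Imp A (Neg (app_code \<rho> A)))"
proof -
  show "\<not> proves U (Imp A (app_code \<rho> A))"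
  proof
    assume "proves U (Imp A (app_code \<rho> A))"
    then obtain w where "evalF (env [w, k, codeF A]) P" using pos_witness by blast
    \<comment> \<open>The stage has to bound both the witness and the code.\<close>
    then have "pos_stage (max w (codeF A)) (codeF A)" by (intro stage_self[of _ _ w]) auto
    then show False using no_stage[OF assms] by blast
  qed
  show "\<not> proves U (Imp A (Neg (app_code \<rho> A)))"
  proof
    assume "proves U (Imp A (Neg (app_code \<rho> A)))"
    then obtain w where "evalF (env [w, k, codeF A]) N" using neg_witness by blast
    then have "neg_stage (max w (codeF A)) (codeF A)" by (intro stage_self[of _ _ w]) auto
    then show False using no_stage[OF assms] by blast
  qed
qed

section \<open>Extensionality inside EA\<close>

lemma EA_StageF_cong:
  assumes "Delta0 F" and AB: "proves U (Iff A B)"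
    and no: "\<And>s. \<not> evalF (env [s, k, codeF A]) (StageF E M F)" "\<And>s. \<not> evalF (env [s, k, codeF B]) (StageF E M F)"
  shows "proves EA (Iff (ap (StageF E M F) [Var 0, num k, num (codeF A)]) (ap (StageF E M F) [Var 0, num k, num (codeF B)]))"
    (is "proves EA (Iff (?S (codeF A)) (?S (codeF B)))")
proof -
  have BA: "proves U (Iff B A)" by (rule taut1[OF AB]) simp
  \<comment> \<open>Closure under \<open>E\<close> is directed, so both orders of the equivalence
    need a witness.\<close>
  obtain v w where v: "evalF (env [v, codeF A, codeF B]) E" and w: "evalF (env [w, codeF B, codeF A]) E"
    using AB BA E_iff equiv_code_iff by blast
  \<comment> \<open>From stage \<open>n\<close> on, both transfers between \<open>A\<close> and
    \<open>B\<close> are available.\<close>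
  define n where "n = max (max v w) (max (codeF A) (codeF B))"
  have n: "v \<le> n" "w \<le> n" "codeF A \<le> n" "codeF B \<le> n" by (auto simp: n_def)
  show ?thesis
  proof (rule EA_by_cases_num)
    show "proves EA (Imp (Leq (num n) (Var 0)) (Iff (?S (codeF A)) (?S (codeF B))))"
      by (rule taut2[OF EA_StageF_transfer[OF Delta0(1) v n(1,3,4)] EA_StageF_transfer[OF Delta0(1) w n(2,4,3)]]) auto
    \<comment> \<open>Up to \<open>n\<close> neither code has a stage. This is a true Delta0
      statement, and it makes both sides of the equivalence false.\<close>
    let ?B = "BAll (Var 0) (Conj (Neg (ap (StageF E M F) [Var 0, Var 2, Var 3])) (Neg (ap (StageF E M F) [Var 0, Var 2, Var 4])))"
    have "evalF (env [n, k, codeF A, codeF B]) ?B"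
      using no by (simp add: evalF_ap) (simp add: env_def numeral_eq_Suc)
    then have "proves EA (ap ?B (map num [n, k, codeF A, codeF B]))"
      by (intro EA_Delta0_true Delta0_BAll Delta0_Conj Delta0_Neg Delta0_psubF Delta0_StageF assms(1) Delta0)
    moreover have "ap ?B (map num [n, k, codeF A, codeF B]) = BAll (num n) (Conj (Neg (?S (codeF A))) (Neg (?S (codeF B))))"
      by (simp add: psubF_ap numeral_eq_Suc del: psubF_psubF)
    ultimately have 1: "proves EA (BAll (num n) (Conj (Neg (?S (codeF A))) (Neg (?S (codeF B)))))" by simp
    have "proves EA (Imp (BAll (num n) (Conj (Neg (?S (codeF A))) (Neg (?S (codeF B))))) (BAll (num n) (Iff (?S (codeF A)) (?S (codeF B)))))"
      by (rule mp[OF BAll_mono[of _ "Imp Fls Fls"]]) (rule taut0, simp)+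
    then show "proves EA (BAll (num n) (Iff (?S (codeF A)) (?S (codeF B))))" using 1 by (rule mp)
  qed
qed

lemma EA_app_code_cong:
  assumes "\<not> proves U (Neg A)" and AB: "proves U (Iff A B)"
  shows "proves EA (Iff (app_code \<rho> A) (app_code \<rho> B))"
proof -
  have "\<not> proves U (Neg B)" using taut2[OF AB, of "Neg B" "Neg A"] assms(1) by auto
  note no = no_stage[OF assms(1)] no_stage[OF this]
  have m: "ap (MatrixF E M P N) [Var 0, num k, num c] = Imp (ap (StageF E M P) [Var 0, num k, num c])
      (BEx (Var 0) (ap (StageF E M N) [Var 0, num k, num c]))" for c
    unfolding MatrixF_def by (simp add: psubF_ap numeral_eq_Suc del: psubF_psubF)
  have p: "proves EA (Iff (ap (StageF E M P) [Var 0, num k, num (codeF A)]) (ap (StageF E M P) [Var 0, num k, num (codeF B)]))"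
    using EA_StageF_cong[OF Delta0(3) AB] no by blast
  have n: "proves EA (Iff (ap (StageF E M N) [Var 0, num k, num (codeF A)]) (ap (StageF E M N) [Var 0, num k, num (codeF B)]))"
    using EA_StageF_cong[OF Delta0(4) AB] no by blast
  have *: "proves EA (Iff (ap (MatrixF E M P N) [Var 0, num k, num (codeF A)]) (ap (MatrixF E M P N) [Var 0, num k, num (codeF B)]))"
    unfolding m by (rule taut2[OF p BEx_cong[OF n, of "Var 0"]]) simp
  have "proves EA (Imp (app_code \<rho> A) (app_code \<rho> B))" "proves EA (Imp (app_code \<rho> B) (app_code \<rho> A))"
    unfolding app_code_\<rho> by (rule Forall_mono, rule taut1[OF *], simp)+
  then show ?thesis by (rule taut2) auto
qed

end

section \<open>Independence and consistent extensionality\<close>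

theorem mainTheorem4:
  fixes U :: "fm set"
  assumes "\<forall>A\<in>U. sentence A"
    and "ce_theory U"
    and "consistent U"
    and "extends_EA U"
  shows "\<exists>\<rho>. Pi1 \<rho> \<and> closedF 1 \<rho> \<and>
    (\<forall>\<phi>. sentence \<phi> \<and> consistent (insert \<phi> U) \<longrightarrow>
        consistent (insert (app_code \<rho> \<phi>) (insert \<phi> U)) \<and>
        consistent (insert (Neg (app_code \<rho> \<phi>)) (insert \<phi> U))) \<and>
    (\<forall>\<phi> \<psi>. sentence \<phi> \<and> sentence \<psi> \<and> consistent (insert \<phi> U) \<and> proves U (Iff \<phi> \<psi>) \<longrightarrow>
        proves EA (Iff (app_code \<rho> \<phi>) (app_code \<rho> \<psi>)))"
proof -
  obtain E where E: "Delta0 E" "\<And>a b. (\<exists>w. evalF (env [w, a, b]) E) \<longleftrightarrow> equiv_code U a b"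
    using ce2_formula[OF ce2_equiv_code[OF assms(2)]] by blast
  obtain P where P: "Delta0 P" "\<And>k c. (\<exists>w. evalF (env [w, k, c]) P) \<longleftrightarrow> asserts_code U k c"
    using ce2_formula[OF ce2_asserts_code[OF assms(2)]] by blast
  obtain N where N: "Delta0 N" "\<And>k c. (\<exists>w. evalF (env [w, k, c]) N) \<longleftrightarrow> denies_code U k c"
    using ce2_formula[OF ce2_denies_code[OF assms(2)]] by blast
  \<comment> \<open>Index 0 is the element and index 1 the set, the argument order used in the stage
    formulas.\<close>
  obtain M where M: "Delta0 M" "\<And>e. evalF e M = bit (e 1) (e 0)"
    using delta0_bit[of 1 0] unfolding delta0_pred_def by blast
  interpret extensional_rosser U E M P N
    using assms(4) E P N M by unfold_locales
  have cons: "\<not> proves U (Neg \<phi>)" if "consistent (insert \<phi> U)" for \<phi>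
  proof
    assume "proves U (Neg \<phi>)"
    then have "proves (insert \<phi> U) (Neg \<phi>)"
      by (rule proves_cut) (auto intro: proves.hyp)
    moreover have "proves (insert \<phi> U) \<phi>" by (rule proves.hyp) simp
    ultimately have "proves (insert \<phi> U) Fls" by (rule taut2) simp
    then show False using that unfolding consistent_def by blast
  qed
  \<comment> \<open>An inconsistency would give, by two uses of the deduction theorem, a proof in
    \<open>U\<close> that \<open>\<phi>\<close> implies the negation of \<open>B\<close>.\<close>
  have indep: "consistent (insert B (insert \<phi> U))"
    if "sentence \<phi>" "sentence B" "\<not> proves U (Imp \<phi> (Neg B))" for \<phi> B
    using deduction_theorem[OF deduction_theorem[OF _ that(2)] that(1)] that(3)
    unfolding consistent_def Neg_def by blast
  show ?thesis
  proof (intro exI[of _ \<rho>] conjI allI impI)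
    fix \<phi> assume \<phi>: "sentence \<phi> \<and> consistent (insert \<phi> U)"
    note not = not_asserts[OF cons, of \<phi>]
    show "consistent (insert (app_code \<rho> \<phi>) (insert \<phi> U))"
      using indep \<phi> not(2) sentence_app_code by blast
    show "consistent (insert (Neg (app_code \<rho> \<phi>)) (insert \<phi> U))"
    proof (rule indep)
      show "sentence (Neg (app_code \<rho> \<phi>))" using sentence_app_code by (simp add: sentence_def)
      show "\<not> proves U (Imp \<phi> (Neg (Neg (app_code \<rho> \<phi>))))"
        using not(1) \<phi> taut1[of U "Imp \<phi> (Neg (Neg (app_code \<rho> \<phi>)))" "Imp \<phi> (app_code \<rho> \<phi>)"] by auto
    qed (use \<phi> in blast)
  qed (use Pi1_\<rho> closedF_\<rho> EA_app_code_cong cons in blast)+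
qed

end
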